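(* Consider a quasi-transitive Branching Markov Chain with underlying Markov chain $(X,P)$ and branching distributions $(\mu_k(x))_{k\ge1}$, $x\in X$, with constant mean offspring $m(x)=\sum_{k\ge1}k\mu_k(x)=m$ for all $x\in X$, where $1<m<\infty$. Let $\rho(P)$ be the spectral radius of $(X,P)$. Then: \begin{itemize} \item the Branching Markov Chain is transient, i.e. $\alpha(x)=0$ for all $x\in X$, if $m\le 1/\rho(P)$; \item the Branching Markov Chain is strongly recurrent, i.e. $\alpha(x)=1$ for all $x\in X$, if $m>1/\rho(P)$. \end{itemize}
   Context: Let $X$ be a locally finite, connected graph (its vertex set, also denoted $X$, is the countable state space) with automorphism group $\mathrm{Aut}(X)$, and let $P=(p(x,y))_{x,y\in X}$ be the transition matrix of an irreducible random walk (Markov chain) on $X$, with $n$-step transition probabilities $p^{(n)}(x,y)$. The spectral radius is $\rho(P):=\limsup_{n\to\infty}p^{(n)}(x,y)^{1/n}\in(0,1]$, which by irreducibility does not depend on $x,y\in X$. For each $x\in X$ let $\mu_1(x),\mu_2(x),\ldots$ be non-negative numbers with $\sum_{k=1}^\infty\mu_k(x)=1$ and $m(x):=\sum_{k=1}^\infty k\mu_k(x)<\infty$ (so every particle has at least one offspring). Branching Markov Chain (BMC): at time $0$ there is one particle at a starting position $x_s\in X$. At each time step, each particle, being at some position $x$, generates $k$ offspring particles at $x$ with probability $\mu_k(x)$ ($k=1,2,\ldots$) and dies; each of the offspring particles then moves independently one step according to $P$. All particles branch and move independently of the other particles and of the previous history of the process. Let $\eta(n)$ be the number of particles at time $n$ and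 $x_1(n),\ldots,x_{\eta(n)}(n)$ their positions. Write $\mathbb{P}_x$ for the law of the process started with $x_s=x$, and set $$\alpha(x)=\mathbb{P}_x\Big(\sum_{n=1}^\infty\sum_{i=1}^{\eta(n)}\mathbf{1}_{\{x_i(n)=x\}}=\infty\Big).$$ Quasi-transitivity: let $\mathrm{Aut}(X,P)$ be the group of all $\gamma\in\mathrm{Aut}(X)$ with $p(\gamma x,\gamma y)=p(x,y)$ for all $x,y\in X$, and let $\mathrm{Aut}(X,P,\mu)$ be the group of all $\gamma\in\mathrm{Aut}(X,P)$ with $\mu_k(x)=\mu_k(\gamma x)$ for all $k\ge1$ and all $x\in X$. The BMC is called quasi-transitive if $\mathrm{Aut}(X,P,\mu)$ acts with finitely many orbits on $X$. *)

theory Defs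
  imports "HOL-Probability.Probability"
begin

text \<open>
  A graph on the vertex type is given by a symmetric adjacency relation; loops are allowed.
\<close>

definition locally_finite_graph :: "('a \<Rightarrow> 'a \<Rightarrow> bool) \<Rightarrow> bool" where
  "locally_finite_graph E \<longleftrightarrow> (\<forall>x. finite {y. E x y})"

definition connected_graph :: "('a \<Rightarrow> 'a \<Rightarrow> bool) \<Rightarrow> bool" where
  "connected_graph E \<longleftrightarrow> (\<forall>x y. E\<^sup>*\<^sup>* x y)"

definition Aut :: "('a \<Rightarrow> 'a \<Rightarrow> bool) \<Rightarrow> ('a \<Rightarrow> 'a) set" where
  "Aut E = {\<gamma>. bij \<gamma> \<and> (\<forall>x y. E (\<gamma> x) (\<gamma> y) \<longleftrightarrow> E x y)}"

text \<open>
  A transition matrix is given by its rows: \<open>p(x,y)\<close> is \<^term>\<open>pmf (P x) y\<close>.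
  No relation between the support of the transition matrix and the edges is required.
\<close>

primrec nstep :: "('a \<Rightarrow> 'a pmf) \<Rightarrow> nat \<Rightarrow> 'a \<Rightarrow> 'a pmf" where
  "nstep P 0 x = return_pmf x"
| "nstep P (Suc n) x = bind_pmf (P x) (nstep P n)"

definition irreducible_chain :: "('a \<Rightarrow> 'a pmf) \<Rightarrow> bool" where
  "irreducible_chain P \<longleftrightarrow> (\<forall>x y. \<exists>n. pmf (nstep P n x) y > 0)"

text \<open>
  For an irreducible chain the value lies in \<open>(0,1]\<close> and is the same for all \<open>x\<close> and \<open>y\<close>.
\<close>

definition spectral_radius :: "('a \<Rightarrow> 'a pmf) \<Rightarrow> 'a \<Rightarrow> 'a \<Rightarrow> ereal" where
  "spectral_radius P x y = limsup (\<lambda>n. ereal (root n (pmf (nstep P n x) y)))"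

definition Aut_chain :: "('a \<Rightarrow> 'a \<Rightarrow> bool) \<Rightarrow> ('a \<Rightarrow> 'a pmf) \<Rightarrow> ('a \<Rightarrow> 'a) set" where
  "Aut_chain E P = {\<gamma> \<in> Aut E. \<forall>x y. pmf (P (\<gamma> x)) (\<gamma> y) = pmf (P x) y}"

definition Aut_bmc ::
    "('a \<Rightarrow> 'a \<Rightarrow> bool) \<Rightarrow> ('a \<Rightarrow> 'a pmf) \<Rightarrow> ('a \<Rightarrow> nat pmf) \<Rightarrow> ('a \<Rightarrow> 'a) set" where
  "Aut_bmc E P \<mu> = {\<gamma> \<in> Aut_chain E P. \<forall>k\<ge>1. \<forall>x. pmf (\<mu> x) k = pmf (\<mu> (\<gamma> x)) k}"

definition quasi_transitive ::
    "('a \<Rightarrow> 'a \<Rightarrow> bool) \<Rightarrow> ('a \<Rightarrow> 'a pmf) \<Rightarrow> ('a \<Rightarrow> nat pmf) \<Rightarrow> bool" where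
  "quasi_transitive E P \<mu> \<longleftrightarrow> finite (range (\<lambda>x. {\<gamma> x |\<gamma>. \<gamma> \<in> Aut_bmc E P \<mu>}))"

text \<open>
  Particles carry Ulam-Harris labels, newest index first: the children of the particle \<open>v\<close> are
  \<open>0 # v, 1 # v, \<dots>\<close>, and the ancestor is \<open>[]\<close>. The sample space provides independent pairs
  \<open>\<omega> (v, x)\<close>, one for each label \<open>v\<close> and each vertex \<open>x\<close>, with independent components: the first
  one, with law \<open>\<mu> x\<close>, is the number of offspring of the particle \<open>v\<close> in case \<open>v\<close> branches at \<open>x\<close>;
  the second one, with law \<open>P x\<close>, is the vertex to which the particle \<open>v\<close> moves in case it is
  born at \<open>x\<close>. The coordinates belonging to vertices at which the particle does not branch or
  is not born are not used.
\<close>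

type_synonym 'a sample = "nat list \<times> 'a \<Rightarrow> nat \<times> 'a"

definition bmc_space :: "('a \<Rightarrow> 'a pmf) \<Rightarrow> ('a \<Rightarrow> nat pmf) \<Rightarrow> 'a sample measure" where
  "bmc_space P \<mu> = (\<Pi>\<^sub>M (v, x)\<in>UNIV. measure_pmf (pair_pmf (\<mu> x) (P x)))"

text \<open>In the following functions \<open>s\<close> is the starting position of the ancestor.\<close>

primrec position :: "'a \<Rightarrow> 'a sample \<Rightarrow> nat list \<Rightarrow> 'a" where
  "position s \<omega> [] = s"
| "position s \<omega> (j # v) = snd (\<omega> (j # v, position s \<omega> v))"

primrec realized :: "'a \<Rightarrow> 'a sample \<Rightarrow> nat list \<Rightarrow> bool" where
  "realized s \<omega> [] \<longleftrightarrow> True"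
| "realized s \<omega> (j # v) \<longleftrightarrow> realized s \<omega> v \<and> j < fst (\<omega> (v, position s \<omega> v))"

definition particles :: "'a \<Rightarrow> 'a sample \<Rightarrow> nat \<Rightarrow> nat list set" where
  "particles s \<omega> n = {v. length v = n \<and> realized s \<omega> v}"

definition visits :: "'a \<Rightarrow> 'a sample \<Rightarrow> 'a \<Rightarrow> ennreal" where
  "visits s \<omega> x = (\<Sum>n. \<Sum>v\<in>particles s \<omega> (Suc n). indicator {x} (position s \<omega> v))"

definition return_prob :: "('a \<Rightarrow> 'a pmf) \<Rightarrow> ('a \<Rightarrow> nat pmf) \<Rightarrow> 'a \<Rightarrow> real" where
  "return_prob P \<mu> x =
     measure (bmc_space P \<mu>) {\<omega> \<in> space (bmc_space P \<mu>). visits x \<omega> x = \<infinity>}"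

definition transient_bmc :: "('a \<Rightarrow> 'a pmf) \<Rightarrow> ('a \<Rightarrow> nat pmf) \<Rightarrow> bool" where
  "transient_bmc P \<mu> \<longleftrightarrow> (\<forall>x. return_prob P \<mu> x = 0)"

definition strongly_recurrent_bmc :: "('a \<Rightarrow> 'a pmf) \<Rightarrow> ('a \<Rightarrow> nat pmf) \<Rightarrow> bool" where
  "strongly_recurrent_bmc P \<mu> \<longleftrightarrow> (\<forall>x. return_prob P \<mu> x = 1)"

lemma prob_space_bmc_space: "prob_space (bmc_space P \<mu>)"
  unfolding bmc_space_def
  by (intro prob_space_PiM) (auto intro: prob_space_measure_pmf)

lemma finite_particles: "finite (particles s \<omega> n)"
proof (induction n)
  case 0
  have "particles s \<omega> 0 \<subseteq> {[]}" by (auto simp: particles_def)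
  then show ?case by (rule finite_subset) simp
next
  case (Suc n)
  have "particles s \<omega> (Suc n) \<subseteq>
      (\<Union>v\<in>particles s \<omega> n. (\<lambda>j. j # v) ` {..<fst (\<omega> (v, position s \<omega> v))})"
    by (auto simp: particles_def length_Suc_conv)
  then show ?case by (rule finite_subset) (use Suc in auto)
qed

lemma measurable_coordinate:
  "(\<lambda>\<omega>. \<omega> i) \<in> measurable (bmc_space P \<mu>) (count_space UNIV)"
proof -
  have "(\<lambda>\<omega>. \<omega> i) \<in> measurable (bmc_space P \<mu>)
      (case i of (v, x) \<Rightarrow> measure_pmf (pair_pmf (\<mu> x) (P x)))"
    unfolding bmc_space_def by (rule measurable_component_singleton) simp
  then show ?thesis by (auto split: prod.splits cong: measurable_cong_sets)
qed

lemma measurable_position: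
  fixes s :: "'a::countable"
  shows "(\<lambda>\<omega>. position s \<omega> v) \<in> measurable (bmc_space P \<mu>) (count_space UNIV)"
proof (induction v)
  case (Cons j v)
  have "(\<lambda>\<omega>. (\<lambda>y \<omega>. snd (\<omega> (j # v, y))) (position s \<omega> v) \<omega>)
      \<in> measurable (bmc_space P \<mu>) (count_space UNIV)"
    by (rule measurable_compose_countable[OF _ Cons])
      (rule measurable_compose[OF measurable_coordinate], simp)
  then show ?case by simp
qed simp

lemma measurable_realized:
  fixes s :: "'a::countable"
  shows "Measurable.pred (bmc_space P \<mu>) (\<lambda>\<omega>. realized s \<omega> v)"
proof (induction v)
  case (Cons j v)
  have "(\<lambda>\<omega>. (\<lambda>y \<omega>. j < fst (\<omega> (v, y))) (position s \<omega> v) \<omega>)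
      \<in> measurable (bmc_space P \<mu>) (count_space UNIV)"
    by (rule measurable_compose_countable[OF _ measurable_position])
      (rule measurable_compose[OF measurable_coordinate], simp)
  with Cons show ?case by simp
qed simp

lemma measurable_visits:
  fixes s :: "'a::countable"
  shows "(\<lambda>\<omega>. visits s \<omega> x) \<in> borel_measurable (bmc_space P \<mu>)"
proof -
  have meas: "(\<lambda>\<omega>. indicator {x} (position s \<omega> v) * (if realized s \<omega> v then 1 else 0 :: ennreal))
      \<in> borel_measurable (bmc_space P \<mu>)" for v
    using measurable_realized[where P = P and \<mu> = \<mu> and s = s and v = v]
    by (intro borel_measurable_times_ennreal measurable_If measurable_const
        measurable_compose[OF measurable_position, of "indicator {x}"]) (simp_all add: pred_def)
  define g :: "nat \<Rightarrow> nat \<Rightarrow> 'a sample \<Rightarrow> ennreal" where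
    "g n k \<omega> = (if k \<in> range (to_nat :: nat list \<Rightarrow> nat) \<and> length (from_nat k :: nat list) = n
      then indicator {x} (position s \<omega> (from_nat k)) * (if realized s \<omega> (from_nat k) then 1 else 0)
      else 0)" for n k \<omega>
  have sum_g: "(\<Sum>v\<in>particles s \<omega> n. indicator {x} (position s \<omega> v)) = (\<Sum>k. g n k \<omega>)" for \<omega> n
  proof -
    have fin: "finite (to_nat ` particles s \<omega> n)"
      by (intro finite_imageI finite_particles)
    have "(\<Sum>k. g n k \<omega>) = (\<Sum>k\<in>to_nat ` particles s \<omega> n. g n k \<omega>)"
      by (rule suminf_finite[OF fin]) (auto simp: g_def particles_def)
    also have "\<dots> = (\<Sum>v\<in>particles s \<omega> n. indicator {x} (position s \<omega> v))"
      by (subst sum.reindex) (auto simp: g_def particles_def intro!: sum.cong)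
    finally show ?thesis by simp
  qed
  have "g n k \<in> borel_measurable (bmc_space P \<mu>)" for n k
    by (cases "k \<in> range (to_nat :: nat list \<Rightarrow> nat) \<and> length (from_nat k :: nat list) = n")
      (auto simp: g_def[abs_def] intro: meas)
  then show ?thesis
    unfolding visits_def sum_g by (intro borel_measurable_suminf_order)
qed

end

theory Submission
  imports Defs
begin

text \<open>
  Whether some descendant sits at \<open>x\<close> is decided independently in the subtrees of the children of
  the ancestor, so as a function of the starting point the probability \<open>H\<close> of hitting \<open>x\<close>, and the
  probability \<open>F\<close> of hitting \<open>x\<close> infinitely often, are governed by the monotone concave operator
  \<open>\<Phi> f s = 1 - G\<^sub>s (1 - P f s)\<close>, where \<open>G\<^sub>s\<close> is the generating function of \<open>\<mu> s\<close>: \<open>\<Phi> F = F\<close>, and \<open>H\<close> is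
  the least supersolution with value \<open>1\<close> at \<open>x\<close>. Moreover \<open>P f \<le> \<Phi> f \<le> m P f\<close>.

  If \<open>m \<le> 1 / \<rho>\<close>, let \<open>g\<close> be the generating function at \<open>m\<close> of the first passage probabilities to \<open>x\<close>.
  A comparison with the Green function gives \<open>m P g x \<le> 1\<close>, and \<open>F \<le> m P F\<close> together with \<open>F \<le> H \<le> g\<close>
  gives \<open>F \<le> F x \<cdot> g\<close>. Hence \<open>m P F x \<le> F x = \<Phi> F x\<close>, and since \<open>\<Phi> F x < m P F x\<close> unless \<open>P F x = 0\<close>,
  it follows that \<open>F x = 0\<close>.

  If \<open>m > 1 / \<rho>\<close>, then \<open>r\<^sup>k p\<^sup>k(z,z) \<ge> 1\<close> for some \<open>r < m\<close> and \<open>k \<ge> 1\<close>, so that a small multiple of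
  \<open>f = (\<Sum>i<k. r\<^sup>i p\<^sup>i(\<cdot>,z))\<close> satisfies \<open>f \<le> \<Phi> f\<close>. By a maximum principle \<open>f \<le> H\<close> for every target \<open>x\<close>,
  so \<open>H\<close> at \<open>z\<close> is bounded below uniformly in \<open>x\<close>, and by quasi-transitivity uniformly in \<open>x\<close> and \<open>z\<close>.
  As \<open>\<Phi>\<close> strictly increases the constants in \<open>(0,1)\<close>, by a uniform amount, \<open>F = 1\<close>.
\<close>

subsection \<open>Independence of the subtrees\<close>

abbreviation (input) offspring_pair :: "('a \<Rightarrow> 'a pmf) \<Rightarrow> ('a \<Rightarrow> nat pmf) \<Rightarrow> nat list \<times> 'a \<Rightarrow> (nat \<times> 'a) measure" where
  "offspring_pair P \<mu> \<equiv> \<lambda>(v, x). measure_pmf (pair_pmf (\<mu> x) (P x))"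

lemma space_bmc_space [simp]: "space (bmc_space P \<mu>) = UNIV"
  by (auto simp: bmc_space_def space_PiM split: prod.splits)

lemma prob_space_offspring_pair: "prob_space (offspring_pair P \<mu> i)"
  by (auto intro: prob_space_measure_pmf split: prod.split)

text \<open>Labels carry the newest index first, so the subtree of child \<open>j\<close> of the
  ancestor consists of the labels \<open>w @ [j]\<close>, and \<open>Some j\<close> relabels it as a
  full tree. Its root coordinate holds the move of child \<open>j\<close>, a component which
  \<open>position\<close> and \<open>realized\<close> never read at the ancestor.
  \<open>None\<close> keeps only the coordinates of the ancestor, copied to all labels, so that all
  blocks live in the same space.\<close>

definition subsample :: "nat option \<Rightarrow> 'a sample \<Rightarrow> 'a sample" where
  "subsample b \<omega> = (\<lambda>(w, x). \<omega> (case b of None \<Rightarrow> ([], x) | Some j \<Rightarrow> (w @ [j], x)))"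

lemma indep_vars_coordinates:
  "prob_space.indep_vars (bmc_space P \<mu>) (offspring_pair P \<mu>) (\<lambda>i \<omega>. \<omega> i) UNIV"
proof -
  interpret prob_space "bmc_space P \<mu>" by (rule prob_space_bmc_space)
  have "distr (bmc_space P \<mu>) (Pi\<^sub>M UNIV (offspring_pair P \<mu>)) (\<lambda>x. \<lambda>i\<in>UNIV. x i) = bmc_space P \<mu>"
    using distr_id[of "bmc_space P \<mu>"] by (simp add: bmc_space_def restrict_UNIV)
  moreover have "(\<Pi>\<^sub>M i\<in>UNIV. distr (bmc_space P \<mu>) (offspring_pair P \<mu> i) (\<lambda>\<omega>. \<omega> i)) = bmc_space P \<mu>"
    unfolding bmc_space_def
    by (intro PiM_cong refl distr_PiM_component prob_space_offspring_pair) auto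
  ultimately show ?thesis
    by (subst indep_vars_iff_distr_eq_PiM') (auto simp: bmc_space_def)
qed

text \<open>The blocks read disjoint coordinate sets \<open>K b\<close>: a label is empty or
  determined to lie in one block by its last entry. Functions of disjoint blocks of independent
  coordinates are independent.\<close>

lemma indep_vars_subsample:
  "prob_space.indep_vars (bmc_space P \<mu>) (\<lambda>_. bmc_space P \<mu>) subsample UNIV"
proof -
  interpret prob_space "bmc_space P \<mu>" by (rule prob_space_bmc_space)
  define K where "K = case_option (range (Pair [])) (\<lambda>j. range (\<lambda>(w, x :: 'a). (w @ [j :: nat], x)))"
  have "indep_vars (\<lambda>b. PiM (K b) (offspring_pair P \<mu>)) (\<lambda>b \<omega>. restrict (\<lambda>i. \<omega> i) (K b)) UNIV"
    by (rule indep_vars_restrict[OF indep_vars_coordinates])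
      (auto simp: disjoint_family_on_def K_def split: option.splits)
  then have "indep_vars (\<lambda>_. bmc_space P \<mu>) (\<lambda>b \<omega>. subsample b (restrict (\<lambda>i. \<omega> i) (K b))) UNIV"
  proof (rule indep_vars_compose2)
    fix b
    have "(\<lambda>\<omega>. \<lambda>i. subsample b \<omega> i) \<in> measurable (PiM (K b) (offspring_pair P \<mu>)) (PiM UNIV (offspring_pair P \<mu>))"
    proof (rule measurable_PiM_single')
      fix i :: "nat list \<times> 'a"
      obtain w x where i: "i = (w, x)" by (cases i)
      let ?i' = "case b of None \<Rightarrow> ([], x) | Some j \<Rightarrow> (w @ [j], x)"
      have "(\<lambda>\<omega>. \<omega> ?i') \<in> measurable (PiM (K b) (offspring_pair P \<mu>)) (offspring_pair P \<mu> ?i')"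
        by (rule measurable_component_singleton) (auto simp: K_def split: option.split)
      then show "(\<lambda>\<omega>. subsample b \<omega> i) \<in> measurable (PiM (K b) (offspring_pair P \<mu>)) (offspring_pair P \<mu> i)"
        by (auto simp: i subsample_def split: option.splits)
    qed auto
    then show "subsample b \<in> measurable (PiM (K b) (offspring_pair P \<mu>)) (bmc_space P \<mu>)"
      by (simp add: bmc_space_def)
  qed
  also have "(\<lambda>b \<omega>. subsample b (restrict (\<lambda>i. \<omega> i) (K b))) = subsample"
    by (auto simp: fun_eq_iff subsample_def K_def split: option.splits)
  finally show ?thesis .
qed

text \<open>The relabelling is injective, and the law of a coordinate depends only on its vertex,
  which the relabelling leaves alone.\<close>

lemma distr_subsample: "distr (bmc_space P \<mu>) (bmc_space P \<mu>) (subsample (Some j)) = bmc_space P \<mu>"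
proof -
  define f where "f = (\<lambda>(w, x :: 'a). (w @ [j], x))"
  have "distr (Pi\<^sub>M UNIV (offspring_pair P \<mu>)) (\<Pi>\<^sub>M i\<in>UNIV. offspring_pair P \<mu> (f i)) (\<lambda>\<omega>. \<lambda>n\<in>UNIV. \<omega> (f n))
      = (\<Pi>\<^sub>M i\<in>UNIV. offspring_pair P \<mu> (f i))"
    by (rule distr_PiM_reindex) (auto simp: f_def inj_on_def intro: prob_space_offspring_pair prob_space_measure_pmf)
  moreover have "offspring_pair P \<mu> (f i) = offspring_pair P \<mu> i" for i
    by (auto simp: f_def split: prod.split)
  moreover have "subsample (Some j) = (\<lambda>\<omega>. \<lambda>n\<in>UNIV. \<omega> (f n))"
    by (auto simp: fun_eq_iff f_def subsample_def)
  ultimately show ?thesis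
    by (simp add: bmc_space_def)
qed

lemma measurable_subsample [measurable]:
  "subsample b \<in> measurable (bmc_space P \<mu>) (bmc_space P \<mu>)"
proof -
  interpret prob_space "bmc_space P \<mu>" by (rule prob_space_bmc_space)
  show ?thesis using indep_vars_subsample[of P \<mu>] by (auto simp: indep_vars_def)
qed

lemma prob_subsamples:
  assumes "A \<in> sets (bmc_space P \<mu>)" and "B \<in> sets (bmc_space P \<mu>)"
  shows "measure (bmc_space P \<mu>) {\<omega>. subsample None \<omega> \<in> A \<and> (\<forall>j<k. subsample (Some j) \<omega> \<in> B)}
    = measure (bmc_space P \<mu>) {\<omega>. subsample None \<omega> \<in> A} * measure (bmc_space P \<mu>) B ^ k"
proof -
  interpret prob_space "bmc_space P \<mu>" by (rule prob_space_bmc_space)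
  let ?J = "insert None (Some ` {..<k})"
  have B: "prob (subsample (Some j) -` B) = prob B" for j
    using measure_distr[OF measurable_subsample assms(2), of "Some j"] by (simp add: distr_subsample)
  have "prob (\<Inter>i\<in>?J. subsample i -` (if i = None then A else B) \<inter> space (bmc_space P \<mu>)) =
      (\<Prod>i\<in>?J. prob (subsample i -` (if i = None then A else B) \<inter> space (bmc_space P \<mu>)))"
    by (rule indep_varsD[OF indep_vars_subsample]) (use assms in auto)
  also have "(\<Inter>i\<in>?J. subsample i -` (if i = None then A else B) \<inter> space (bmc_space P \<mu>))
      = {\<omega>. subsample None \<omega> \<in> A \<and> (\<forall>j<k. subsample (Some j) \<omega> \<in> B)}"
    by (auto simp: image_iff)
  also have "(\<Prod>i\<in>?J. prob (subsample i -` (if i = None then A else B) \<inter> space (bmc_space P \<mu>)))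
      = prob (subsample None -` A) * (\<Prod>i\<in>Some ` {..<k}. prob (subsample i -` B))"
    by (subst prod.insert) (auto intro!: arg_cong2[of _ _ _ _ "(*)"] prod.cong)
  also have "(\<Prod>i\<in>Some ` {..<k}. prob (subsample i -` B)) = prob B ^ k"
    by (subst prod.reindex) (auto simp: B)
  finally show ?thesis by (simp add: vimage_def)
qed

lemma prob_coordinate:
  "measure (bmc_space P \<mu>) {\<omega>. \<omega> (v, x) \<in> A} = measure_pmf.prob (pair_pmf (\<mu> x) (P x)) A"
proof -
  have "distr (bmc_space P \<mu>) (offspring_pair P \<mu> (v, x)) (\<lambda>\<omega>. \<omega> (v, x)) = offspring_pair P \<mu> (v, x)"
    unfolding bmc_space_def by (rule distr_PiM_component) (auto intro: prob_space_measure_pmf)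
  moreover have "measure (distr (bmc_space P \<mu>) (offspring_pair P \<mu> (v, x)) (\<lambda>\<omega>. \<omega> (v, x))) A
      = measure (bmc_space P \<mu>) {\<omega>. \<omega> (v, x) \<in> A}"
    by (subst measure_distr)
      (use measurable_coordinate[of "(v, x)" P \<mu>] in \<open>auto simp: vimage_def cong: measurable_cong_sets\<close>)
  ultimately show ?thesis by simp
qed

lemma prob_root_fst: "measure (bmc_space P \<mu>) {\<omega>. fst (\<omega> ([], x)) = k} = pmf (\<mu> x) k"
proof -
  have "measure (bmc_space P \<mu>) {\<omega>. fst (\<omega> ([], x)) = k} =
      measure_pmf.prob (map_pmf fst (pair_pmf (\<mu> x) (P x))) {k}"
    using prob_coordinate[of P \<mu> "[]" x "fst -` {k}"] by (simp add: vimage_def)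
  then show ?thesis by (simp add: map_fst_pair_pmf measure_pmf_single)
qed

text \<open>The product form has two sources: for \<open>y = s\<close> both quantities are
  components of one pair with independent components, otherwise they belong to two independent
  coordinates.\<close>

lemma prob_root:
  "measure (bmc_space P \<mu>) {\<omega>. fst (\<omega> ([], y)) = k \<and> snd (\<omega> ([], s)) = y} = pmf (\<mu> y) k * pmf (P s) y"
proof -
  interpret prob_space "bmc_space P \<mu>" by (rule prob_space_bmc_space)
  have snd: "prob {\<omega>. snd (\<omega> ([], x)) = y} = pmf (P x) y" for x
  proof -
    have "prob {\<omega>. snd (\<omega> ([], x)) = y} = measure_pmf.prob (map_pmf snd (pair_pmf (\<mu> x) (P x))) {y}"
      using prob_coordinate[of P \<mu> "[]" x "snd -` {y}"] by (simp add: vimage_def)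
    then show ?thesis by (simp add: map_snd_pair_pmf measure_pmf_single)
  qed
  show ?thesis
  proof (cases "y = s")
    case True
    then have "{\<omega>. fst (\<omega> ([], y)) = k \<and> snd (\<omega> ([], s)) = y} = {\<omega>. \<omega> ([], s) \<in> {(k, y)}}"
      by (auto simp: prod_eq_iff)
    then show ?thesis
      using prob_coordinate[of P \<mu> "[]" s "{(k, y)}"] True by (simp add: measure_pmf_single pmf_pair prod_eq_iff)
  next
    case False
    have "prob (\<Inter>i\<in>{([], y), ([], s)}. (\<lambda>\<omega>. \<omega> i) -` (if i = ([], y) then fst -` {k} else snd -` {y}) \<inter> space (bmc_space P \<mu>)) =
        (\<Prod>i\<in>{([], y), ([], s)}. prob ((\<lambda>\<omega>. \<omega> i) -` (if i = ([], y) then fst -` {k} else snd -` {y}) \<inter> space (bmc_space P \<mu>)))"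
      by (rule indep_varsD[OF indep_vars_coordinates]) auto
    then show ?thesis
      using False prob_root_fst[of P \<mu> y] snd[of s] by (simp add: vimage_def Collect_conj_eq)
  qed
qed

subsection \<open>The recursion for hitting probabilities\<close>

text \<open>Total probability over the values of \<open>Z\<close>, with \<open>h z\<close> in the
  role of the conditional probability of \<open>Q\<close>. The product form also covers values of
  weight zero.\<close>

lemma (in prob_space) prob_partition_pmf:
  fixes Z :: "'a \<Rightarrow> 'b::countable"
  assumes [measurable]: "Z \<in> measurable M (count_space UNIV)" "Measurable.pred M Q"
    and h: "\<And>z. 0 \<le> h z"
    and eq: "\<And>z. prob {\<omega> \<in> space M. Q \<omega> \<and> Z \<omega> = z} = pmf q z * h z"
  shows "prob {\<omega> \<in> space M. Q \<omega>} = measure_pmf.expectation q h"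
proof -
  have "emeasure M {\<omega> \<in> space M. Q \<omega>} = emeasure M (\<Union>z. {\<omega> \<in> space M. Q \<omega> \<and> Z \<omega> = z})"
    by (rule arg_cong[of _ _ "emeasure M"]) auto
  also have "\<dots> = (\<integral>\<^sup>+z. emeasure M {\<omega> \<in> space M. Q \<omega> \<and> Z \<omega> = z} \<partial>count_space UNIV)"
    by (rule emeasure_UN_countable) (auto simp: disjoint_family_on_def)
  also have "\<dots> = (\<integral>\<^sup>+z. ennreal (pmf q z) * ennreal (h z) \<partial>count_space UNIV)"
    by (simp add: emeasure_eq_measure eq ennreal_mult h)
  also have "\<dots> = (\<integral>\<^sup>+z. ennreal (h z) \<partial>measure_pmf q)"
    by (simp add: nn_integral_measure_pmf)
  finally have "ennreal (prob {\<omega> \<in> space M. Q \<omega>}) = (\<integral>\<^sup>+z. ennreal (h z) \<partial>measure_pmf q)"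
    by (simp add: emeasure_eq_measure)
  then show ?thesis
    by (subst integral_eq_nn_integral) (auto simp: h dest!: arg_cong[of _ _ enn2real])
qed

text \<open>The set \<open>L\<close> of admissible generations lets a single recursion serve three
  cases: \<open>{..n}\<close> for a finite horizon, \<open>UNIV\<close> for hitting at all, and
  \<open>{N..}\<close> for late hits.\<close>

definition hit :: "nat set \<Rightarrow> 'a \<Rightarrow> 'a \<Rightarrow> 'a sample \<Rightarrow> bool" where
  "hit L x s \<omega> \<longleftrightarrow> (\<exists>w. length w \<in> L \<and> realized s \<omega> w \<and> position s \<omega> w = x)"

definition hit_prob :: "('a \<Rightarrow> 'a pmf) \<Rightarrow> ('a \<Rightarrow> nat pmf) \<Rightarrow> nat set \<Rightarrow> 'a \<Rightarrow> 'a \<Rightarrow> real" where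
  "hit_prob P \<mu> L x s = measure (bmc_space P \<mu>) {\<omega>. hit L x s \<omega>}"

text \<open>The probability that some child is marked when each child is marked independently with
  probability \<open>t\<close>.\<close>

definition marked_prob :: "nat pmf \<Rightarrow> real \<Rightarrow> real" where
  "marked_prob q t = 1 - measure_pmf.expectation q (\<lambda>k. (1 - t) ^ k)"

definition branching_op :: "('a \<Rightarrow> 'a pmf) \<Rightarrow> ('a \<Rightarrow> nat pmf) \<Rightarrow> ('a \<Rightarrow> real) \<Rightarrow> 'a \<Rightarrow> real" where
  "branching_op P \<mu> f s = marked_prob (\<mu> s) (measure_pmf.expectation (P s) f)"

lemma position_append:
  "position s \<omega> (w @ [j]) =
    position (snd (subsample (Some j) \<omega> ([], s))) (subsample (Some j) \<omega>) w"
  by (induction w) (auto simp: subsample_def)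

lemma realized_append:
  "realized s \<omega> (w @ [j]) \<longleftrightarrow> j < fst (\<omega> ([], s)) \<and>
    realized (snd (subsample (Some j) \<omega> ([], s))) (subsample (Some j) \<omega>) w"
proof (induction w)
  case (Cons i w)
  then show ?case
    using position_append[of s \<omega> w j] by (auto simp: subsample_def)
qed (auto simp: subsample_def)

text \<open>Splitting off the last entry of a label separates the first generation from the rest of
  the line of descent; the empty label accounts for the ancestor itself.\<close>

lemma hit_rec:
  "hit L x s \<omega> \<longleftrightarrow> (0 \<in> L \<and> s = x) \<or> (\<exists>j<fst (\<omega> ([], s)).
    hit {n. Suc n \<in> L} x (snd (subsample (Some j) \<omega> ([], s))) (subsample (Some j) \<omega>))"
  (is "?l \<longleftrightarrow> ?r")
proof
  assume ?l
  then obtain w where w: "length w \<in> L" "realized s \<omega> w" "position s \<omega> w = x"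
    by (auto simp: hit_def)
  show ?r
  proof (cases w rule: rev_cases)
    case (snoc u j)
    then show ?thesis
      using w by (auto simp: hit_def position_append realized_append)
  qed (use w in auto)
next
  assume ?r
  then show ?l
  proof
    assume "\<exists>j<fst (\<omega> ([], s)).
      hit {n. Suc n \<in> L} x (snd (subsample (Some j) \<omega> ([], s))) (subsample (Some j) \<omega>)"
    then obtain j w where "j < fst (\<omega> ([], s))" "Suc (length w) \<in> L"
        "realized (snd (subsample (Some j) \<omega> ([], s))) (subsample (Some j) \<omega>) w"
        "position (snd (subsample (Some j) \<omega> ([], s))) (subsample (Some j) \<omega>) w = x"
      by (auto simp: hit_def)
    then show ?l
      unfolding hit_def by (intro exI[of _ "w @ [j]"]) (simp add: position_append realized_append)
  qed (auto simp: hit_def intro: exI[of _ "[]"])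
qed

lemma measurable_root [measurable]:
  "(\<lambda>\<omega>. fst (\<omega> ([], s))) \<in> measurable (bmc_space P \<mu>) (count_space UNIV)"
  "(\<lambda>\<omega>. snd (\<omega> ([], s))) \<in> measurable (bmc_space P \<mu>) (count_space UNIV)"
  by (rule measurable_compose[OF measurable_coordinate], simp)+

lemma measurable_hit [measurable]:
  fixes s :: "'a::countable"
  shows "Measurable.pred (bmc_space P \<mu>) (hit L x s)"
proof -
  have "Measurable.pred (bmc_space P \<mu>) (\<lambda>\<omega>. length w \<in> L \<and> realized s \<omega> w \<and> position s \<omega> w = x)" for w
    using measurable_realized[where P = P and \<mu> = \<mu> and s = s and v = w]
      measurable_compose[OF measurable_position[where P = P and \<mu> = \<mu> and s = s and v = w], of "\<lambda>y. y = x" "count_space UNIV"]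
    by (intro pred_intros_logic) auto
  then show ?thesis
    unfolding hit_def[abs_def] by (intro pred_intros_countable)
qed

lemma measurable_hit_child [measurable]:
  fixes s :: "'a::countable"
  shows "Measurable.pred (bmc_space P \<mu>) (\<lambda>\<omega>. hit L x (snd (\<omega> ([], s))) \<omega>)"
  by (rule measurable_compose_countable[of "\<lambda>y \<omega>. hit L x y \<omega>"]) measurable

text \<open>Invariance under \<open>subsample None\<close> expresses that \<open>R\<close> depends
  on the coordinates of the ancestor only. Hence \<open>R\<close> and the offspring number are
  jointly independent of the subtrees, and given \<open>k\<close> children all \<open>k\<close>
  independent subtrees have to miss \<open>x\<close>. The first assumption keeps the ancestor itself
  from being a hit.\<close>

lemma prob_miss_children:
  fixes P :: "'a::countable \<Rightarrow> 'a pmf"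
  assumes "0 \<notin> L \<or> y \<noteq> x" "R \<in> sets (bmc_space P \<mu>)"
    and R: "\<And>\<omega>. subsample None \<omega> \<in> R \<longleftrightarrow> \<omega> \<in> R"
    and prob: "\<And>k. measure (bmc_space P \<mu>) {\<omega> \<in> R. fst (\<omega> ([], y)) = k} = c * pmf (\<mu> y) k"
    and c: "c \<ge> 0"
  shows "measure (bmc_space P \<mu>) {\<omega> \<in> R. \<not> hit L x y \<omega>} =
    c * measure_pmf.expectation (\<mu> y) (\<lambda>k.
      measure (bmc_space P \<mu>) {\<omega>. \<not> hit {n. Suc n \<in> L} x (snd (\<omega> ([], y))) \<omega>} ^ k)"
proof -
  interpret prob_space "bmc_space P \<mu>" by (rule prob_space_bmc_space)
  note assms(2)[measurable]
  let ?B = "{\<omega>. \<not> hit {n. Suc n \<in> L} x (snd (\<omega> ([], y))) \<omega>}"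
  have B: "?B \<in> events"
    using measurable_hit_child[where P = P and \<mu> = \<mu> and L = "{n. Suc n \<in> L}" and x = x and s = y]
    by (simp add: pred_def Collect_neg_eq sets.compl_sets[of _ "bmc_space P \<mu>", simplified] Compl_eq_Diff_UNIV)
  have root: "subsample None \<omega> ([], y) = \<omega> ([], y)" for \<omega> :: "'a sample"
    by (simp add: subsample_def)
  have meas: "Measurable.pred (bmc_space P \<mu>) (\<lambda>\<omega>. \<omega> \<in> R \<and> \<not> hit L x y \<omega>)"
    by measurable
  have "prob {\<omega> \<in> space (bmc_space P \<mu>). \<omega> \<in> R \<and> \<not> hit L x y \<omega>} =
      measure_pmf.expectation (\<mu> y) (\<lambda>k. c * prob ?B ^ k)"
  proof (rule prob_partition_pmf[where Z = "\<lambda>\<omega>. fst (\<omega> ([], y))"])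
    fix k
    have Rk: "{\<omega> \<in> R. fst (\<omega> ([], y)) = k} \<in> events" by measurable
    have "{\<omega> \<in> space (bmc_space P \<mu>). (\<omega> \<in> R \<and> \<not> hit L x y \<omega>) \<and> fst (\<omega> ([], y)) = k} =
        {\<omega>. subsample None \<omega> \<in> {\<omega> \<in> R. fst (\<omega> ([], y)) = k} \<and> (\<forall>j<k. subsample (Some j) \<omega> \<in> ?B)}"
      using assms(1) by (auto simp: R root hit_rec[of L x y])
    also have "prob \<dots> = prob {\<omega>. subsample None \<omega> \<in> {\<omega> \<in> R. fst (\<omega> ([], y)) = k}} * prob ?B ^ k"
      by (rule prob_subsamples[OF Rk B])
    also have "{\<omega>. subsample None \<omega> \<in> {\<omega> \<in> R. fst (\<omega> ([], y)) = k}} = {\<omega> \<in> R. fst (\<omega> ([], y)) = k}"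
      by (auto simp: R root)
    finally show "prob {\<omega> \<in> space (bmc_space P \<mu>). (\<omega> \<in> R \<and> \<not> hit L x y \<omega>) \<and> fst (\<omega> ([], y)) = k} =
        pmf (\<mu> y) k * (c * prob ?B ^ k)"
      by (simp add: prob)
  qed (use c meas in auto)
  then show ?thesis by simp
qed

text \<open>The move from \<open>s\<close> to \<open>y\<close> is independent of the tree started at
  \<open>y\<close>, since at the root that tree uses only the offspring number. This is obtained by
  evaluating \<open>prob_miss_children\<close> twice, with \<open>R\<close> the event of this move
  and with \<open>R = UNIV\<close>; if \<open>y\<close> itself counts as a hit, both sides
  vanish.\<close>

lemma prob_miss_child:
  fixes P :: "'a::countable \<Rightarrow> 'a pmf" and s :: 'a
  shows "measure (bmc_space P \<mu>) {\<omega>. \<not> hit L x (snd (\<omega> ([], s))) \<omega>} =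
    1 - measure_pmf.expectation (P s) (hit_prob P \<mu> L x)"
proof -
  interpret prob_space "bmc_space P \<mu>" by (rule prob_space_bmc_space)
  have compl: "prob {\<omega>. \<not> hit L x y \<omega>} = 1 - hit_prob P \<mu> L x y" for y :: 'a
    using prob_neg[of "hit L x y"] measurable_hit[where P = P and \<mu> = \<mu> and L = L and x = x and s = y] by (simp add: hit_prob_def pred_def)
  have "prob {\<omega> \<in> space (bmc_space P \<mu>). \<not> hit L x (snd (\<omega> ([], s))) \<omega>} =
      measure_pmf.expectation (P s) (\<lambda>y. prob {\<omega>. \<not> hit L x y \<omega>})"
  proof (rule prob_partition_pmf[where Z = "\<lambda>\<omega>. snd (\<omega> ([], s))"])
    fix y :: 'a
    let ?R = "{\<omega>. snd (\<omega> ([], s)) = y}"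
    have "prob {\<omega> \<in> ?R. \<not> hit L x y \<omega>} = pmf (P s) y * prob {\<omega>. \<not> hit L x y \<omega>}"
    proof (cases "0 \<in> L \<and> y = x")
      case True
      then have "hit L x y \<omega>" for \<omega> by (simp add: hit_rec[of L])
      then show ?thesis by simp
    next
      case False
      have sets: "?R \<in> events"
        using measurable_sets[OF measurable_root(2)[where P = P and \<mu> = \<mu> and s = s], of "{y}"]
        by (simp add: vimage_def)
      have 1: "prob {\<omega> \<in> ?R. \<not> hit L x y \<omega>} = pmf (P s) y * measure_pmf.expectation (\<mu> y)
          (\<lambda>k. prob {\<omega>. \<not> hit {n. Suc n \<in> L} x (snd (\<omega> ([], y))) \<omega>} ^ k)"
        by (rule prob_miss_children)
          (use False sets in \<open>auto simp: subsample_def mult.commute prob_root[of P \<mu> y _ s, unfolded conj_commute[of "fst _ = _"]]\<close>)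
      have "prob {\<omega>. fst (\<omega> ([], y)) = k} = pmf (\<mu> y) k" for k
        by (rule prob_root_fst)
      then have "prob {\<omega> \<in> UNIV. \<not> hit L x y \<omega>} = 1 * measure_pmf.expectation (\<mu> y)
          (\<lambda>k. prob {\<omega>. \<not> hit {n. Suc n \<in> L} x (snd (\<omega> ([], y))) \<omega>} ^ k)"
        by (intro prob_miss_children) (use False sets.top[of "bmc_space P \<mu>"] in auto)
      with 1 show ?thesis by simp
    qed
    then show "prob {\<omega> \<in> space (bmc_space P \<mu>). \<not> hit L x (snd (\<omega> ([], s))) \<omega> \<and> snd (\<omega> ([], s)) = y} =
        pmf (P s) y * prob {\<omega>. \<not> hit L x y \<omega>}"
      by (simp add: conj_commute cong: conj_cong)
  qed auto
  also have "\<dots> = measure_pmf.expectation (P s) (\<lambda>y. 1 - hit_prob P \<mu> L x y)"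
    by (simp add: compl)
  also have "\<dots> = 1 - measure_pmf.expectation (P s) (hit_prob P \<mu> L x)"
    by (subst Bochner_Integration.integral_diff)
      (auto intro!: measure_pmf.integrable_const_bound[where B = 1] simp: hit_prob_def)
  finally show ?thesis by simp
qed

lemma hit_prob_rec:
  fixes P :: "'a::countable \<Rightarrow> 'a pmf"
  shows "hit_prob P \<mu> L x s =
    (if 0 \<in> L \<and> s = x then 1 else branching_op P \<mu> (hit_prob P \<mu> {n. Suc n \<in> L} x) s)"
proof (cases "0 \<in> L \<and> s = x")
  interpret prob_space "bmc_space P \<mu>" by (rule prob_space_bmc_space)
  case True
  then have "hit L x s \<omega>" for \<omega> by (simp add: hit_rec[of L])
  with True show ?thesis using prob_space by (simp add: hit_prob_def)
next
  interpret prob_space "bmc_space P \<mu>" by (rule prob_space_bmc_space)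
  case False
  have "prob {\<omega> \<in> UNIV. \<not> hit L x s \<omega>} = 1 * measure_pmf.expectation (\<mu> s)
      (\<lambda>k. prob {\<omega>. \<not> hit {n. Suc n \<in> L} x (snd (\<omega> ([], s))) \<omega>} ^ k)"
    by (intro prob_miss_children) (use False sets.top[of "bmc_space P \<mu>"] prob_root_fst in auto)
  moreover have "prob {\<omega>. \<not> hit L x s \<omega>} = 1 - hit_prob P \<mu> L x s"
    using prob_neg[of "hit L x s"] measurable_hit[where P = P and \<mu> = \<mu> and L = L and x = x and s = s] by (simp add: hit_prob_def pred_def)
  ultimately show ?thesis
    using False by (auto simp: branching_op_def marked_prob_def prob_miss_child)
qed

subsection \<open>Generating functions of the offspring\<close>

lemma expectation_pmf_less:
  fixes f g :: "'b \<Rightarrow> real"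
  assumes "integrable (measure_pmf q) f" "integrable (measure_pmf q) g"
    and "\<And>k. k \<in> set_pmf q \<Longrightarrow> f k \<le> g k" and "i \<in> set_pmf q" "f i < g i"
  shows "measure_pmf.expectation q f < measure_pmf.expectation q g"
  by (rule measure_pmf.integral_less_AE[where A = "{i}"])
    (use assms in \<open>auto simp: emeasure_pmf_single pmf_eq_0_set_pmf AE_measure_pmf_iff\<close>)

locale offspring_law =
  fixes q :: "nat pmf" and m :: real
  assumes no_death: "pmf q 0 = 0"
    and sums_mean: "(\<lambda>k. real k * pmf q k) sums m"
    and mean_gt_1: "1 < m"
begin

abbreviation \<phi> :: "real \<Rightarrow> real" where "\<phi> \<equiv> marked_prob q"

lemma offspring_ge_1: "k \<in> set_pmf q \<Longrightarrow> 1 \<le> k"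
  using no_death by (cases k) (auto simp: set_pmf_iff)

lemma integrable_mean: "integrable (measure_pmf q) real"
  and expectation_mean: "measure_pmf.expectation q real = m"
proof -
  have "(\<integral>\<^sup>+k. ennreal (real k) \<partial>measure_pmf q) = (\<Sum>k. ennreal (real k * pmf q k))"
    by (simp add: nn_integral_measure_pmf nn_integral_count_space_nat ennreal_mult mult.commute)
  also have "\<dots> = ennreal m"
    using sums_mean by (intro suminf_ennreal_eq) auto
  finally have *: "(\<integral>\<^sup>+k. ennreal (real k) \<partial>measure_pmf q) = ennreal m" .
  then show "integrable (measure_pmf q) real"
    by (intro integrableI_nonneg) auto
  show "measure_pmf.expectation q real = m"
    using * mean_gt_1 by (subst integral_eq_nn_integral) auto
qed

lemma ex_offspring_ge_2: "\<exists>k\<in>set_pmf q. 2 \<le> k"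
proof (rule ccontr)
  assume "\<not> ?thesis"
  then have "measure_pmf.expectation q real \<le> measure_pmf.expectation q (\<lambda>_. 1)"
    by (intro integral_mono_AE integrable_mean) (auto simp: AE_measure_pmf_iff)
  then show False using mean_gt_1 by (simp add: expectation_mean)
qed

lemma integrable_power [simp]:
  assumes "0 \<le> t" "t \<le> 1"
  shows "integrable (measure_pmf q) (\<lambda>k. (1 - t) ^ k :: real)"
  by (rule measure_pmf.integrable_const_bound[where B = 1])
    (use assms in \<open>auto simp: power_le_one\<close>)

lemma marked_prob_altdef:
  assumes "0 \<le> t" "t \<le> 1"
  shows "\<phi> t = measure_pmf.expectation q (\<lambda>k. 1 - (1 - t) ^ k)"
  using assms by (simp add: marked_prob_def)

lemma marked_prob_0 [simp]: "\<phi> 0 = 0"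
  by (simp add: marked_prob_def)

lemma marked_prob_le_1: "0 \<le> t \<Longrightarrow> t \<le> 1 \<Longrightarrow> \<phi> t \<le> 1"
  unfolding marked_prob_def by (simp add: integral_nonneg_AE)

lemma marked_prob_mono: "0 \<le> s \<Longrightarrow> s \<le> t \<Longrightarrow> t \<le> 1 \<Longrightarrow> \<phi> s \<le> \<phi> t"
  unfolding marked_prob_def by (auto intro!: integral_mono power_mono)

lemma convex_power_unit:
  fixes a b u :: real
  assumes "0 \<le> a" "0 \<le> b" "0 \<le> u" "u \<le> 1"
  shows "(u * a + (1 - u) * b) ^ k \<le> u * a ^ k + (1 - u) * b ^ k"
proof (cases "k = 0")
  case False
  have "convex_on {0..} (\<lambda>x :: real. x ^ k)"
    by (cases "even k") (auto intro: convex_on_subset[OF convex_power_even] convex_power_odd)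
  from convex_onD[OF this, of "1 - u" a b] show ?thesis using assms by simp
qed simp

text \<open>Each power \<open>(1 - t) ^ k\<close> is convex in \<open>t\<close>, hence so is their
  mean, which enters with a minus sign.\<close>

lemma marked_prob_concave:
  assumes "0 \<le> a" "a \<le> 1" "0 \<le> b" "b \<le> 1" "0 \<le> u" "u \<le> 1"
  shows "u * \<phi> a + (1 - u) * \<phi> b \<le> \<phi> (u * a + (1 - u) * b)"
proof -
  have c: "0 \<le> u * a + (1 - u) * b" "u * a + (1 - u) * b \<le> 1"
    using assms convex_bound_le[of a 1 b u "1 - u"] by auto
  have "measure_pmf.expectation q (\<lambda>k. (1 - (u * a + (1 - u) * b)) ^ k)
      \<le> measure_pmf.expectation q (\<lambda>k. u * (1 - a) ^ k + (1 - u) * (1 - b) ^ k)"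
  proof (rule integral_mono)
    fix k
    have "1 - (u * a + (1 - u) * b) = u * (1 - a) + (1 - u) * (1 - b)" by algebra
    then show "(1 - (u * a + (1 - u) * b)) ^ k \<le> u * (1 - a) ^ k + (1 - u) * (1 - b) ^ k"
      using convex_power_unit[of "1 - a" "1 - b" u k] assms by simp
  qed (use assms c in auto)
  then show ?thesis
    using assms by (simp add: marked_prob_def algebra_simps)
qed

lemma marked_prob_scale:
  assumes "0 \<le> t" "t \<le> 1" "0 \<le> c" "c \<le> 1"
  shows "c * \<phi> t \<le> \<phi> (c * t)"
  using marked_prob_concave[of t 0 c] assms by simp

lemma marked_prob_ge:
  assumes "0 \<le> t" "t \<le> 1"
  shows "t \<le> \<phi> t"
proof -
  have "measure_pmf.expectation q (\<lambda>k. (1 - t) ^ k) \<le> measure_pmf.expectation q (\<lambda>k. 1 - t)"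
  proof (rule integral_mono_AE)
    have "(1 - t) ^ k \<le> 1 - t" if "k \<in> set_pmf q" for k
      using power_decreasing[of 1 k "1 - t"] offspring_ge_1[OF that] assms by simp
    then show "AE k in measure_pmf q. (1 - t) ^ k \<le> 1 - t"
      by (simp add: AE_measure_pmf_iff)
  qed (use assms in auto)
  then show ?thesis by (simp add: marked_prob_def)
qed

lemma marked_prob_gt:
  assumes "0 < t" "t < 1"
  shows "t < \<phi> t"
proof -
  obtain i where i: "i \<in> set_pmf q" "2 \<le> i" using ex_offspring_ge_2 by auto
  have "measure_pmf.expectation q (\<lambda>k. (1 - t) ^ k) < measure_pmf.expectation q (\<lambda>k. 1 - t)"
  proof (rule expectation_pmf_less[OF _ _ _ i(1)])
    show "(1 - t) ^ k \<le> 1 - t" if "k \<in> set_pmf q" for k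
      using power_decreasing[of 1 k "1 - t"] offspring_ge_1[OF that] assms by simp
    show "(1 - t) ^ i < 1 - t"
      using power_strict_decreasing[of 1 i "1 - t"] i assms by simp
  qed (use assms in auto)
  then show ?thesis by (simp add: marked_prob_def)
qed

lemma marked_prob_less_mean:
  assumes "0 < t" "t \<le> 1"
  shows "\<phi> t < m * t"
proof -
  obtain i where i: "i \<in> set_pmf q" "2 \<le> i" using ex_offspring_ge_2 by auto
  have bern: "1 + real k * (- t) \<le> (1 + (- t)) ^ k" for k
    by (rule Bernoulli_inequality) (use assms in simp)
  have "measure_pmf.expectation q (\<lambda>k. 1 - (1 - t) ^ k) < measure_pmf.expectation q (\<lambda>k. real k * t)"
  proof (rule expectation_pmf_less[OF _ _ _ i(1)])
    show "1 - (1 - t) ^ k \<le> real k * t" for k using bern[of k] by simp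
    \<comment> \<open>Bernoulli's inequality is used at exponent \<open>i - 1\<close> and multiplied
      by \<open>1 - t\<close>. This leaves the slack \<open>(i - 1) * t * t\<close>, positive
      because \<open>i \<ge> 2\<close>, and gives strictness even at \<open>t = 1\<close>.\<close>
    have "(1 - real (i - 1) * t) * (1 - t) \<le> (1 - t) ^ (i - 1) * (1 - t)"
      using bern[of "i - 1"] assms by (intro mult_right_mono) auto
    also have "\<dots> = (1 - t) ^ i" using i by (simp flip: power_Suc2)
    finally have "1 - (1 - t) ^ i \<le> real i * t - real (i - 1) * t * t"
      using i by (simp add: algebra_simps of_nat_diff)
    moreover have "0 < real (i - 1) * t * t" using i assms by simp
    ultimately show "1 - (1 - t) ^ i < real i * t" by linarith
  qed (use assms integrable_mean in auto)
  also have "measure_pmf.expectation q (\<lambda>k. real k * t) = m * t"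
    by (simp add: expectation_mean)
  finally show ?thesis using assms by (simp add: marked_prob_altdef)
qed

lemma marked_prob_le_mean:
  assumes "0 \<le> t" "t \<le> 1"
  shows "\<phi> t \<le> m * t"
  using marked_prob_less_mean[of t] assms by (cases "t = 0") auto

text \<open>The slope at \<open>0\<close> is the mean \<open>m\<close>. Truncating the offspring sum
  where the partial mean already exceeds \<open>r\<close> gives a polynomial minorant
  \<open>h\<close>, whose derivative at \<open>0\<close> is that partial mean, so only a first
  moment enters.\<close>

lemma marked_prob_ge_near_0:
  assumes "r < m"
  shows "\<exists>\<delta>>0. \<forall>t. 0 \<le> t \<and> t \<le> \<delta> \<longrightarrow> r * t \<le> \<phi> t"
proof -
  have "eventually (\<lambda>K. r < (\<Sum>k<K. real k * pmf q k)) sequentially"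
    using sums_mean assms by (auto simp: sums_def dest: order_tendstoD)
  then obtain K where K: "r < (\<Sum>k<K. real k * pmf q k)"
    by (auto simp: eventually_sequentially)
  define h where "h t = (\<Sum>k<K. (1 - (1 - t) ^ k) * pmf q k)" for t :: real
  have h_le: "h t \<le> \<phi> t" if t: "0 \<le> t" "t \<le> 1" for t
  proof -
    have "h t = measure_pmf.expectation q (\<lambda>k. if k < K then 1 - (1 - t) ^ k else 0)"
      unfolding h_def by (subst integral_measure_pmf_real[of "{..<K}"]) (auto split: if_splits)
    also have "\<dots> \<le> measure_pmf.expectation q (\<lambda>k. 1 - (1 - t) ^ k)"
      using t by (intro integral_mono measure_pmf.integrable_const_bound[where B = 1])
        (auto simp: power_le_one)
    finally show ?thesis using t by (simp add: marked_prob_altdef)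
  qed
  have "(h has_real_derivative (\<Sum>k<K. real k * pmf q k)) (at 0)"
    unfolding h_def by (auto intro!: derivative_eq_intros sum.cong)
  then have "((\<lambda>t. h t / t) \<longlongrightarrow> (\<Sum>k<K. real k * pmf q k)) (at 0)"
    by (simp add: has_field_derivative_iff h_def)
  then have "eventually (\<lambda>t. r < h t / t) (at 0)"
    using K by (rule order_tendstoD)
  then obtain d where d: "d > 0" "\<And>t. t \<noteq> 0 \<Longrightarrow> dist t 0 < d \<Longrightarrow> r < h t / t"
    by (auto simp: eventually_at)
  show ?thesis
  \<comment> \<open>The bound \<open>1\<close> keeps \<open>h t \<le> \<phi> t\<close> available;
    halving \<open>d\<close> turns the strict condition on the distance into
    \<open>t \<le> \<delta>\<close>.\<close>
  proof (intro exI[of _ "min 1 (d / 2)"] conjI allI impI)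
    fix t assume t: "0 \<le> t \<and> t \<le> min 1 (d / 2)"
    show "r * t \<le> \<phi> t"
    proof (cases "t = 0")
      case False
      then have "r < h t / t" using t d by auto
      then show ?thesis using False t h_le[of t] by (simp add: field_simps)
    qed simp
  qed (use d in auto)
qed

end

subsection \<open>Hitting probabilities\<close>

lemma pmf_nstep_Suc:
  "pmf (nstep P (Suc n) x) y = measure_pmf.expectation (P x) (\<lambda>z. pmf (nstep P n z) y)"
  by (simp add: pmf_bind)

lemma integrable_unit_interval [simp]:
  "(\<And>s. 0 \<le> f s \<and> f s \<le> (1 :: real)) \<Longrightarrow> integrable (measure_pmf p) f"
  by (rule measure_pmf.integrable_const_bound[where B = 1]) auto

lemma expectation_unit_interval:
  assumes "\<And>s. 0 \<le> f s \<and> f s \<le> (1 :: real)"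
  shows "0 \<le> measure_pmf.expectation p f" "measure_pmf.expectation p f \<le> 1"
  using assms by (auto intro!: integral_nonneg_AE measure_pmf.integral_le_const)

text \<open>Only the intermediate point \<open>y\<close> is kept in the Chapman-Kolmogorov
  sum.\<close>

lemma pmf_nstep_add_ge:
  "pmf (nstep P a x) y * pmf (nstep P b y) z \<le> pmf (nstep P (a + b) x) z"
proof (induction a arbitrary: x)
  case 0
  then show ?case by (simp add: indicator_def)
next
  case (Suc a)
  have "pmf (nstep P (Suc a) x) y * pmf (nstep P b y) z =
      measure_pmf.expectation (P x) (\<lambda>w. pmf (nstep P a w) y * pmf (nstep P b y) z)"
    by (simp add: pmf_nstep_Suc del: nstep.simps)
  also have "\<dots> \<le> measure_pmf.expectation (P x) (\<lambda>w. pmf (nstep P (a + b) w) z)"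
    by (intro integral_mono Suc integrable_unit_interval) (auto simp: pmf_le_1 mult_le_one)
  finally show ?case by (simp add: pmf_nstep_Suc del: nstep.simps)
qed

lemma hit_prob_unit: "0 \<le> hit_prob P \<mu> L x s \<and> hit_prob P \<mu> L x s \<le> 1"
proof -
  interpret prob_space "bmc_space P \<mu>" by (rule prob_space_bmc_space)
  show ?thesis by (simp add: hit_prob_def)
qed

lemma hit_prob_nonneg [simp]: "0 \<le> hit_prob P \<mu> L x s"
  and hit_prob_le_1 [simp]: "hit_prob P \<mu> L x s \<le> 1"
  by (simp_all add: hit_prob_unit)

lemma hit_events [simp]:
  fixes s :: "'a::countable"
  shows "{\<omega>. hit L x s \<omega>} \<in> sets (bmc_space P \<mu>)"
  using measurable_hit[where P = P and \<mu> = \<mu> and L = L and x = x and s = s] by (simp add: pred_def)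

lemma hit_mono: "hit L x s \<omega> \<Longrightarrow> L \<subseteq> L' \<Longrightarrow> hit L' x s \<omega>"
  unfolding hit_def by blast

lemma hit_prob_mono:
  fixes s :: "'a::countable"
  assumes "L \<subseteq> L'"
  shows "hit_prob P \<mu> L x s \<le> hit_prob P \<mu> L' x s"
proof -
  interpret prob_space "bmc_space P \<mu>" by (rule prob_space_bmc_space)
  show ?thesis
    unfolding hit_prob_def by (rule finite_measure_mono) (use assms in \<open>auto elim: hit_mono\<close>)
qed

section \<open>Infinitely many visits as a limit of late hitting events\<close>

definition inf_hit_prob :: "('a \<Rightarrow> 'a pmf) \<Rightarrow> ('a \<Rightarrow> nat pmf) \<Rightarrow> 'a \<Rightarrow> 'a \<Rightarrow> real" where
  "inf_hit_prob P \<mu> x s = measure (bmc_space P \<mu>) {\<omega>. \<forall>N. hit {N..} x s \<omega>}"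

lemma hit_prob_tendsto_inf:
  fixes s :: "'a::countable"
  shows "(\<lambda>N. hit_prob P \<mu> {N..} x s) \<longlonglongrightarrow> inf_hit_prob P \<mu> x s"
proof -
  interpret prob_space "bmc_space P \<mu>" by (rule prob_space_bmc_space)
  have "(\<lambda>N. prob {\<omega>. hit {N..} x s \<omega>}) \<longlonglongrightarrow> prob (\<Inter>N. {\<omega>. hit {N..} x s \<omega>})"
    by (rule finite_Lim_measure_decseq) (auto simp: decseq_def elim: hit_mono)
  moreover have "(\<Inter>N. {\<omega>. hit {N..} x s \<omega>}) = {\<omega>. \<forall>N. hit {N..} x s \<omega>}" by auto
  ultimately show ?thesis by (simp add: hit_prob_def inf_hit_prob_def)
qed

lemma hit_prob_atMost_tendsto:
  fixes s :: "'a::countable"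
  shows "(\<lambda>n. hit_prob P \<mu> {..n} x s) \<longlonglongrightarrow> hit_prob P \<mu> UNIV x s"
proof -
  interpret prob_space "bmc_space P \<mu>" by (rule prob_space_bmc_space)
  have "(\<lambda>n. prob {\<omega>. hit {..n} x s \<omega>}) \<longlonglongrightarrow> prob (\<Union>n. {\<omega>. hit {..n} x s \<omega>})"
    by (rule finite_Lim_measure_incseq) (auto simp: incseq_def elim: hit_mono)
  moreover have "(\<Union>n. {\<omega>. hit {..n} x s \<omega>}) = {\<omega>. hit UNIV x s \<omega>}"
    by (auto simp: hit_def)
  ultimately show ?thesis by (simp add: hit_prob_def)
qed

text \<open>Every generation is finite, so its number of visits \<open>c n\<close> is finite, and it
  is at least \<open>1\<close> unless it vanishes. The sum is therefore infinite exactly when visits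
  occur in arbitrarily late generations.\<close>

lemma visits_infinite_iff: "visits s \<omega> x = \<infinity> \<longleftrightarrow> (\<forall>N. hit {N..} x s \<omega>)"
proof -
  define c :: "nat \<Rightarrow> ennreal" where
    "c n = (\<Sum>v\<in>particles s \<omega> (Suc n). indicator {x} (position s \<omega> v))" for n
  have c_0: "c n = 0 \<longleftrightarrow> (\<forall>w. length w = Suc n \<and> realized s \<omega> w \<longrightarrow> position s \<omega> w \<noteq> x)" for n
    by (subst c_def, subst sum_eq_0_iff[OF finite_particles]) (auto simp: particles_def indicator_eq_0_iff)
  have c_1: "1 \<le> c n" if n: "c n \<noteq> 0" for n
  proof -
    obtain w where w: "w \<in> particles s \<omega> (Suc n)" "position s \<omega> w = x"
      using n by (auto simp: c_0 particles_def)
    then have "indicator {x} (position s \<omega> w) \<le> c n"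
      unfolding c_def by (intro member_le_sum finite_particles) auto
    then show ?thesis using w by simp
  qed
  have c_fin: "c n < \<infinity>" for n
    by (auto simp: c_def sum_Pinfty less_top[symmetric] finite_particles indicator_def)
  show ?thesis
  proof
    assume inf: "visits s \<omega> x = \<infinity>"
    show "\<forall>N. hit {N..} x s \<omega>"
    proof (rule ccontr)
      assume "\<not> ?thesis"
      then obtain N where "\<not> hit {N..} x s \<omega>" by auto
      then have "c n = 0" if "n \<notin> {..<N}" for n
        using that by (auto simp: c_0 hit_def)
      then have "(\<Sum>n. c n) = (\<Sum>n<N. c n)" by (intro suminf_finite) auto
      also have "\<dots> < \<infinity>" using c_fin by (simp add: less_top[symmetric])
      finally show False using inf by (simp add: visits_def c_def)
    qed
  next
    assume hit: "\<forall>N. hit {N..} x s \<omega>"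
    have "\<exists>n\<ge>N. c n \<noteq> 0" for N
    proof -
      \<comment> \<open>\<open>c n\<close> counts generation \<open>Suc n\<close>, so the index
        belonging to \<open>w\<close> is \<open>length w - 1\<close>, and \<open>Suc N\<close> makes
        it at least \<open>N\<close>.\<close>
      obtain w where "Suc N \<le> length w" "realized s \<omega> w" "position s \<omega> w = x"
        using hit by (auto simp: hit_def)
      then show ?thesis
        by (intro exI[of _ "length w - 1"]) (auto simp: c_0 intro!: exI[of _ w])
    qed
    then have inf: "infinite {n. c n \<noteq> 0}"
      by (auto simp: infinite_nat_iff_unbounded_le)
    have "of_nat k \<le> (\<Sum>n. c n)" for k
    proof -
      obtain S where S: "S \<subseteq> {n. c n \<noteq> 0}" "finite S" "card S = k"
        using infinite_arbitrarily_large[OF inf] by blast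
      have "of_nat k = (\<Sum>n\<in>S. 1 :: ennreal)" using S by simp
      also have "\<dots> \<le> (\<Sum>n\<in>S. c n)" using S c_1 by (intro sum_mono) auto
      also have "\<dots> \<le> (\<Sum>n. c n)" using S by (intro sum_le_suminf) auto
      finally show ?thesis .
    qed
    then have "\<not> (\<Sum>n. c n) < \<infinity>"
      using ennreal_Ex_less_of_nat[of "\<Sum>n. c n"] by (auto simp: not_less[symmetric])
    then have "(\<Sum>n. c n) = \<infinity>" by (simp add: less_top[symmetric])
    then show "visits s \<omega> x = \<infinity>" by (simp add: visits_def c_def)
  qed
qed

lemma return_prob_eq: "return_prob P \<mu> x = inf_hit_prob P \<mu> x x"
  by (simp add: return_prob_def inf_hit_prob_def visits_infinite_iff[unfolded infinity_ennreal_def])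

section \<open>The branching operator and comparison with hitting probabilities\<close>

locale branching_chain =
  fixes P :: "'a::countable \<Rightarrow> 'a pmf" and \<mu> :: "'a \<Rightarrow> nat pmf" and m :: real
  assumes offspring: "\<And>x. offspring_law (\<mu> x) m"
    and irreducible: "irreducible_chain P"
begin

abbreviation \<Phi> :: "('a \<Rightarrow> real) \<Rightarrow> 'a \<Rightarrow> real" where "\<Phi> \<equiv> branching_op P \<mu>"
abbreviation H :: "nat set \<Rightarrow> 'a \<Rightarrow> 'a \<Rightarrow> real" where "H \<equiv> hit_prob P \<mu>"

lemma branching_op_mono:
  assumes "\<And>s. 0 \<le> f s \<and> f s \<le> 1" "\<And>s. 0 \<le> g s \<and> g s \<le> 1" "\<And>s. f s \<le> g s"
  shows "\<Phi> f s \<le> \<Phi> g s"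
  unfolding branching_op_def using assms
  by (intro offspring_law.marked_prob_mono[OF offspring] integral_mono expectation_unit_interval integrable_unit_interval) auto

lemma branching_op_ge:
  assumes "\<And>s. 0 \<le> f s \<and> f s \<le> 1"
  shows "measure_pmf.expectation (P s) f \<le> \<Phi> f s"
  unfolding branching_op_def using assms
  by (intro offspring_law.marked_prob_ge[OF offspring] expectation_unit_interval) auto

lemma branching_op_le_1:
  assumes "\<And>s. 0 \<le> f s \<and> f s \<le> 1"
  shows "\<Phi> f s \<le> 1"
  unfolding branching_op_def using assms
  by (intro offspring_law.marked_prob_le_1[OF offspring] expectation_unit_interval) auto

lemma branching_op_scale:
  assumes "\<And>s. 0 \<le> f s \<and> f s \<le> 1" "0 \<le> c" "c \<le> 1"
  shows "c * \<Phi> f s \<le> \<Phi> (\<lambda>s. c * f s) s"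
  unfolding branching_op_def using assms offspring_law.marked_prob_scale[OF offspring]
  by (simp add: expectation_unit_interval)

lemma branching_op_concave:
  assumes "\<And>s. 0 \<le> f s \<and> f s \<le> 1" "\<And>s. 0 \<le> g s \<and> g s \<le> 1" "0 \<le> u" "u \<le> 1"
  shows "u * \<Phi> f s + (1 - u) * \<Phi> g s \<le> \<Phi> (\<lambda>s. u * f s + (1 - u) * g s) s"
  using assms offspring_law.marked_prob_concave[OF offspring, of "measure_pmf.expectation (P s) f"
      "measure_pmf.expectation (P s) g" u s]
  by (simp add: branching_op_def expectation_unit_interval)

lemma H_self [simp]: "0 \<in> L \<Longrightarrow> H L x x = 1"
  by (subst hit_prob_rec) simp

lemma H_UNIV_step: "s \<noteq> x \<Longrightarrow> \<Phi> (H UNIV x) s = H UNIV x s"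
  using hit_prob_rec[of P \<mu> UNIV x s] by simp

lemma H_UNIV_super: "\<Phi> (H UNIV x) s \<le> H UNIV x s"
  by (cases "s = x") (auto simp: H_UNIV_step branching_op_le_1 hit_prob_unit)

lemma H_atMost_Suc: "s \<noteq> x \<Longrightarrow> H {..Suc n} x s = \<Phi> (H {..n} x) s"
  using hit_prob_rec[of P \<mu> "{..Suc n}" x s] by (simp add: atMost_def)

lemma H_atMost_0: "s \<noteq> x \<Longrightarrow> H {0} x s = 0"
  by (simp add: hit_prob_def hit_def)

lemma H_atLeast_Suc: "H {Suc N..} x s = \<Phi> (H {N..} x) s"
  using hit_prob_rec[of P \<mu> "{Suc N..}" x s] by (simp add: atLeast_def)

text \<open>The finite-horizon probabilities arise by iterating \<open>\<Phi>\<close> from the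
  indicator of \<open>x\<close>, with the value \<open>1\<close> kept at \<open>x\<close>.
  Monotonicity holds each iterate below \<open>f\<close>, and so also the limit.\<close>

lemma H_UNIV_least:
  assumes "\<And>s. 0 \<le> f s \<and> f s \<le> 1" "f x = 1" and "\<And>s. s \<noteq> x \<Longrightarrow> \<Phi> f s \<le> f s"
  shows "H UNIV x s \<le> f s"
proof -
  have "H {..n} x s \<le> f s" for n
  proof (induction n arbitrary: s)
    case 0
    then show ?case using assms by (cases "s = x") (simp_all add: H_atMost_0)
  next
    case (Suc n)
    show ?case
    proof (cases "s = x")
      case False
      then have "H {..Suc n} x s = \<Phi> (H {..n} x) s" by (rule H_atMost_Suc)
      also have "\<dots> \<le> \<Phi> f s" by (rule branching_op_mono) (use assms(1) Suc in auto)
      finally show ?thesis using assms(3)[OF False] by simp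
    qed (simp add: assms)
  qed
  then show ?thesis
    by (intro LIMSEQ_le_const2[OF hit_prob_atMost_tendsto]) auto
qed

text \<open>A descendant at \<open>y\<close> can go on to produce one at \<open>x\<close>. The
  formal argument is a comparison: by concavity the factor \<open>H UNIV x y\<close> can be moved
  inside \<open>\<Phi>\<close>, and \<open>H UNIV x\<close> is a supersolution.\<close>

lemma H_UNIV_trans: "H UNIV x y * H UNIV y s \<le> H UNIV x s"
proof -
  have "H UNIV x y * H {..n} y s \<le> H UNIV x s" for n
  proof (induction n arbitrary: s)
    case 0
    show ?case by (cases "s = y") (simp_all add: H_atMost_0 hit_prob_unit)
  next
    case (Suc n)
    show ?case
    proof (cases "s = y")
      case False
      have "H UNIV x y * H {..Suc n} y s = H UNIV x y * \<Phi> (H {..n} y) s"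
        using False by (simp add: H_atMost_Suc)
      also have "\<dots> \<le> \<Phi> (\<lambda>s. H UNIV x y * H {..n} y s) s"
        by (rule branching_op_scale) auto
      also have "\<dots> \<le> \<Phi> (H UNIV x) s"
        by (rule branching_op_mono) (use Suc in \<open>auto intro!: mult_le_one\<close>)
      also have "\<dots> \<le> H UNIV x s" by (rule H_UNIV_super)
      finally show ?thesis .
    qed simp
  qed
  then show ?thesis
    by (intro LIMSEQ_le_const2[OF tendsto_mult_left[OF hit_prob_atMost_tendsto]]) auto
qed

text \<open>Every particle has a child, so some line of descent follows the chain; in terms of
  operators this is \<open>P f \<le> \<Phi> f\<close>.\<close>

lemma pmf_nstep_le_H: "pmf (nstep P n s) x \<le> H UNIV x s"
proof (induction n arbitrary: s)
  case 0
  show ?case by (cases "s = x") (simp_all add: hit_prob_unit)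
next
  case (Suc n)
  have "pmf (nstep P (Suc n) s) x = measure_pmf.expectation (P s) (\<lambda>z. pmf (nstep P n z) x)"
    by (rule pmf_nstep_Suc)
  also have "\<dots> \<le> measure_pmf.expectation (P s) (H UNIV x)"
    by (intro integral_mono Suc integrable_unit_interval) (auto simp: pmf_le_1 hit_prob_unit)
  also have "\<dots> \<le> \<Phi> (H UNIV x) s" by (rule branching_op_ge) (rule hit_prob_unit)
  also have "\<dots> \<le> H UNIV x s" by (rule H_UNIV_super)
  finally show ?case .
qed

lemma H_UNIV_pos: "0 < H UNIV x s"
proof -
  obtain n where "0 < pmf (nstep P n s) x"
    using irreducible by (auto simp: irreducible_chain_def)
  then show ?thesis using pmf_nstep_le_H[of n s x] by linarith
qed

text \<open>
  A maximum principle. The function \<open>p\<close> in the proof lies on the line through \<open>b\<close> and the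
  hitting probability \<open>a\<close>, beyond \<open>a\<close>; concavity makes it a supersolution below \<open>a\<close>, which
  contradicts the minimality of \<open>a\<close> unless \<open>b = a\<close>.
\<close>

lemma subsolution_le_H:
  assumes f: "\<And>s. 0 \<le> f s \<and> f s \<le> 1" "\<And>s. f s \<le> \<Phi> f s" and C: "\<And>s. f s \<le> C * H UNIV x s"
  shows "f s \<le> H UNIV x s"
proof -
  define a where "a = H UNIV x"
  define b where "b s = max (a s) (f s)" for s
  \<comment> \<open>The step beyond \<open>a\<close> is chosen so that \<open>p\<close> stays
    nonnegative: the assumption on \<open>C\<close> gives
    \<open>b - a \<le> max 1 C * a\<close>.\<close>
  define e where "e = 1 / max 1 C"
  define p where "p s = a s - e * (b s - a s)" for s
  have a: "0 \<le> a s \<and> a s \<le> 1" "0 < a s" for s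
    unfolding a_def by (auto simp: hit_prob_unit H_UNIV_pos)
  have b: "0 \<le> b s \<and> b s \<le> 1" "a s \<le> b s" "f s \<le> b s" for s
    using a[of s] f(1)[of s] by (auto simp: b_def max_def)
  have e: "0 < e" "e \<le> 1" by (auto simp: e_def)
  have p_le: "p s \<le> a s" for s using b(2)[of s] e by (simp add: p_def)
  have p_nonneg: "0 \<le> p s" for s
  proof -
    have "f s \<le> max 1 C * a s"
      using C[of s] a(2)[of s] mult_right_mono[of C "max 1 C" "a s"] unfolding a_def by linarith
    moreover have "a s \<le> max 1 C * a s"
      using a(2)[of s] mult_right_mono[of 1 "max 1 C" "a s"] by simp
    ultimately have "b s - a s \<le> max 1 C * a s" using a(2)[of s] unfolding b_def by linarith
    then have "e * (b s - a s) \<le> e * (max 1 C * a s)" using e by (intro mult_left_mono) auto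
    also have "\<dots> = a s" by (simp add: e_def)
    finally show ?thesis by (simp add: p_def)
  qed
  have p: "0 \<le> p s \<and> p s \<le> 1" for s
    using p_nonneg[of s] p_le[of s] a(1)[of s] by auto
  define u where "u = 1 / (1 + e)"
  have u: "0 < u" "u < 1" "1 - u = u * e" using e by (auto simp: u_def field_simps)
  have a_eq: "a = (\<lambda>s. u * p s + (1 - u) * b s)"
  proof
    fix s
    have "u * p s + (1 - u) * b s = (u + u * e) * a s"
      by (simp add: u(3) p_def algebra_simps)
    then show "a s = u * p s + (1 - u) * b s" using u(3) by simp
  qed
  have "a s \<le> p s"
    unfolding a_def
  proof (rule H_UNIV_least)
    show "p x = 1" using f(1)[of x] by (simp add: p_def b_def a_def max_absorb1)
    fix s assume "s \<noteq> x"
    then have "a s = \<Phi> a s" by (simp add: a_def H_UNIV_step)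
    also have "\<Phi> a s \<le> \<Phi> b s" by (rule branching_op_mono) (use a b in auto)
    finally have "a s \<le> \<Phi> b s" .
    moreover have "f s \<le> \<Phi> b s"
      using f(2)[of s] branching_op_mono[of f b s] f(1) b by force
    ultimately have "b s \<le> \<Phi> b s" by (simp add: b_def)
    \<comment> \<open>\<open>a\<close> is the convex combination of \<open>p\<close> and
      \<open>b\<close> with weight \<open>u\<close>. Inserting \<open>b \<le> \<Phi> b\<close> into
      concavity and cancelling \<open>(1 - u) * b\<close> leaves
      \<open>\<Phi> p \<le> p\<close>.\<close>
    have "u * \<Phi> p s + (1 - u) * b s \<le> u * \<Phi> p s + (1 - u) * \<Phi> b s"
      using u \<open>b s \<le> \<Phi> b s\<close> by (intro add_left_mono mult_left_mono) auto
    also have "\<dots> \<le> \<Phi> a s"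
      by (subst a_eq, rule branching_op_concave) (use p b u in auto)
    also have "\<dots> = u * p s + (1 - u) * b s"
      using \<open>a s = \<Phi> a s\<close> a_eq by metis
    finally have "u * \<Phi> p s \<le> u * p s" by simp
    then show "\<Phi> p s \<le> p s" using u by simp
  qed (rule p)
  then have "b s \<le> a s" using e by (simp add: p_def mult_le_0_iff)
  then show ?thesis using b(3)[of s] by (simp add: a_def)
qed

section \<open>Uniform lower bounds on hitting and certainty of infinitely many visits\<close>

lemma marked_prob_ge_uniform:
  assumes "finite (range \<mu>)" "r < m"
  shows "\<exists>\<delta>>0. \<forall>s t. 0 \<le> t \<and> t \<le> \<delta> \<longrightarrow> r * t \<le> marked_prob (\<mu> s) t"
proof -
  have "\<exists>\<delta>>0. \<forall>q\<in>Q. \<forall>t. 0 \<le> t \<and> t \<le> \<delta> \<longrightarrow> r * t \<le> marked_prob q t"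
    if "finite Q" "Q \<subseteq> range \<mu>" for Q
    using that
  proof (induction Q)
    case (insert q Q)
    then obtain d where d: "d > 0" "\<forall>q\<in>Q. \<forall>t. 0 \<le> t \<and> t \<le> d \<longrightarrow> r * t \<le> marked_prob q t"
      by auto
    obtain s where s: "q = \<mu> s" using insert by auto
    obtain d' where d': "d' > 0" "\<forall>t. 0 \<le> t \<and> t \<le> d' \<longrightarrow> r * t \<le> marked_prob q t"
      using offspring_law.marked_prob_ge_near_0[OF offspring[of s] assms(2)] s by auto
    show ?case using d d' by (intro exI[of _ "min d d'"]) auto
  qed (auto intro: exI[of _ 1])
  from this[OF assms(1)] show ?thesis by auto
qed

lemma H_ge_from_supercritical:
  assumes "finite (range \<mu>)" and r: "0 < r" "r < m" and k: "1 \<le> k" "1 \<le> r ^ k * pmf (nstep P k z) z"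
  shows "\<exists>\<epsilon>>0. \<forall>x. \<epsilon> \<le> H UNIV x z"
proof -
  obtain d where d: "d > 0" "\<And>s t. 0 \<le> t \<Longrightarrow> t \<le> d \<Longrightarrow> r * t \<le> marked_prob (\<mu> s) t"
    using marked_prob_ge_uniform[OF assms(1) r(2)] by auto
  define B where "B = (\<Sum>i<k. r ^ i)"
  define f where "f s = (\<Sum>i<k. r ^ i * pmf (nstep P i s) z)" for s
  have "r ^ 0 \<le> B" unfolding B_def using k r by (intro member_le_sum) auto
  then have B: "1 \<le> B" by simp
  have f_nonneg: "0 \<le> f s" for s using r by (auto simp: f_def intro!: sum_nonneg)
  have f_le: "f s \<le> B * H UNIV z s" for s
    unfolding f_def B_def sum_distrib_right using r
    by (intro sum_mono mult_left_mono pmf_nstep_le_H) auto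
  have f_B: "f s \<le> B" for s
    using f_le[of s] mult_left_le[of "H UNIV z s" B] B hit_prob_unit[of P \<mu> UNIV z s] by linarith
  have "r ^ 0 * pmf (nstep P 0 z) z \<le> f z"
    unfolding f_def using k r by (intro member_le_sum) auto
  then have f_z: "1 \<le> f z" by simp
  have f_sub: "f s \<le> r * measure_pmf.expectation (P s) f" for s
  proof -
    \<comment> \<open>Multiplying by \<open>r\<close> and taking one step shifts the index, so only
      the two end terms change. The lost term is \<open>1\<close> at \<open>s = z\<close> and
      \<open>0\<close> elsewhere, and at \<open>z\<close> the gained term is at least
      \<open>1\<close> by the choice of \<open>k\<close>.\<close>
    have "r * measure_pmf.expectation (P s) f = (\<Sum>i<k. r ^ Suc i * pmf (nstep P (Suc i) s) z)"
      unfolding f_def pmf_nstep_Suc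
      by (subst Bochner_Integration.integral_sum)
        (auto simp: sum_distrib_left mult_ac pmf_le_1)
    also have "\<dots> = (\<Sum>i\<in>{1..<Suc k}. r ^ i * pmf (nstep P i s) z)"
      using sum.shift_bounds_Suc_ivl[of "\<lambda>i. r ^ i * pmf (nstep P i s) z" 0 k] by (simp add: lessThan_atLeast0 del: nstep.simps)
    also have "\<dots> = f s + r ^ k * pmf (nstep P k s) z - pmf (nstep P 0 s) z"
      unfolding f_def using k by (simp add: lessThan_atLeast0 sum.atLeast_Suc_lessThan del: nstep.simps(2))
    also have "\<dots> \<ge> f s"
      using k(2) r by (cases "s = z") auto
    finally show ?thesis .
  qed
  \<comment> \<open>\<open>d\<close> keeps \<open>g\<close> in the range where
    \<open>marked_prob\<close> dominates the line of slope \<open>r\<close>; the bound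
    \<open>1\<close> makes the values of \<open>g\<close> admissible as probabilities.\<close>
  define d' where "d' = min d 1"
  have d': "0 < d'" "d' \<le> d" "d' \<le> 1" using d by (auto simp: d'_def)
  define g where "g s = d' / B * f s" for s
  have g: "0 \<le> g s" "g s \<le> d'" for s
  proof -
    show "0 \<le> g s" using d' B f_nonneg[of s] by (simp add: g_def)
    have "g s \<le> d' / B * B" unfolding g_def using d' B f_B[of s] by (intro mult_left_mono) auto
    then show "g s \<le> d'" using B by simp
  qed
  have g1: "0 \<le> g s \<and> g s \<le> 1" for s using g[of s] d' by linarith
  have g_sub: "g s \<le> \<Phi> g s" for s
  proof -
    have "g s \<le> d' / B * (r * measure_pmf.expectation (P s) f)"
      unfolding g_def using f_sub[of s] d' B by (intro mult_left_mono) auto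
    also have "\<dots> = r * measure_pmf.expectation (P s) g"
      by (simp add: g_def[abs_def])
    also have "\<dots> \<le> \<Phi> g s"
      unfolding branching_op_def
    proof (rule d(2))
      show "measure_pmf.expectation (P s) g \<le> d"
        using g d' g1 by (intro measure_pmf.integral_le_const integrable_unit_interval) (auto intro: order_trans)
    qed (rule expectation_unit_interval, rule g1)
    finally show ?thesis .
  qed
  have "d' / B \<le> H UNIV x z" for x
  proof -
    have "g z \<le> H UNIV x z"
    proof (rule subsolution_le_H[OF g1 g_sub])
      fix s
      have "g s \<le> d' / B * (B * H UNIV z s)"
        unfolding g_def using d' B f_le[of s] by (intro mult_left_mono) auto
      also have "\<dots> = d' * H UNIV z s" using B by simp
      \<comment> \<open>The constant needed for the maximum principle depends on \<open>x\<close>,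
        but does not enter its conclusion. This is why the lower bound at \<open>z\<close> is
        uniform over all targets.\<close>
      also have "\<dots> \<le> d' * (H UNIV x s / H UNIV x z)"
        using H_UNIV_trans[of x z s] H_UNIV_pos[of x z] d' by (intro mult_left_mono) (auto simp: field_simps)
      finally show "g s \<le> d' / H UNIV x z * H UNIV x s" by simp
    qed
    moreover have "d' / B * 1 \<le> g z"
      unfolding g_def using d' B f_z by (intro mult_left_mono) auto
    ultimately show ?thesis by simp
  qed
  then show ?thesis using d' B by (intro exI[of _ "d' / B"]) auto
qed

text \<open>Let \<open>I\<close> be the infimum over all starting points and all tails
  \<open>{N..}\<close>. If \<open>0 < I < 1\<close>, one application of \<open>\<Phi>\<close> lifts
  it strictly, and by a uniform amount because there are finitely many offspring laws. The lifted
  bound holds for every tail, contradicting the infimum.\<close>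

lemma inf_hit_prob_eq_1:
  assumes "finite (range \<mu>)" and e: "0 < \<epsilon>" "\<And>s. \<epsilon> \<le> H UNIV x s"
  shows "inf_hit_prob P \<mu> x s = 1"
proof -
  define I where "I = (INF (N, s)\<in>UNIV. H {N..} x s)"
  have bdd: "bdd_below (range (\<lambda>(N, s). H {N..} x s))"
    by (rule bdd_belowI[of _ 0]) (auto simp: hit_prob_unit)
  have I_le: "I \<le> H {N..} x s" for N s
    using cINF_lower[OF bdd, of "(N, s)"] by (simp add: I_def)
  \<comment> \<open>The positive bound passes to later tails because \<open>\<Phi>\<close> dominates
    averaging under \<open>P\<close>; this makes \<open>I\<close> positive.\<close>
  have ge_e: "\<epsilon> \<le> H {N..} x s" for N s
  proof (induction N arbitrary: s)
    case 0
    then show ?case using e by (simp add: atLeast_0)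
  next
    case (Suc N)
    have "\<epsilon> \<le> measure_pmf.expectation (P s) (H {N..} x)"
      by (intro measure_pmf.integral_ge_const integrable_unit_interval hit_prob_unit) (simp add: Suc)
    also have "\<dots> \<le> H {Suc N..} x s"
      unfolding H_atLeast_Suc by (rule branching_op_ge) (rule hit_prob_unit)
    finally show ?case .
  qed
  have "\<epsilon> \<le> I" unfolding I_def by (rule cINF_greatest) (auto intro: ge_e)
  with e have I: "0 < I" by simp
  have "1 \<le> I"
  proof (rule ccontr)
    assume "\<not> 1 \<le> I"
    then have "I < 1" by simp
    define J where "J = Min ((\<lambda>q. marked_prob q I) ` range \<mu>)"
    have fin: "finite ((\<lambda>q. marked_prob q I) ` range \<mu>)" using assms(1) by (rule finite_imageI)
    have "I < marked_prob (\<mu> s) I" for s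
      by (rule offspring_law.marked_prob_gt[OF offspring]) fact+
    then have "I < J" unfolding J_def by (subst Min_gr_iff[OF fin]) auto
    have "J \<le> H {N..} x s" for N s
    proof -
      have "J \<le> marked_prob (\<mu> s) I" unfolding J_def by (rule Min_le[OF fin]) auto
      also have "\<dots> \<le> marked_prob (\<mu> s) (measure_pmf.expectation (P s) (H {N..} x))"
      proof (rule offspring_law.marked_prob_mono[OF offspring])
        show "I \<le> measure_pmf.expectation (P s) (H {N..} x)"
          by (intro measure_pmf.integral_ge_const integrable_unit_interval hit_prob_unit) (simp add: I_le)
      qed (use I in \<open>auto intro!: expectation_unit_interval hit_prob_unit\<close>)
      also have "\<dots> = H {Suc N..} x s" by (simp add: H_atLeast_Suc branching_op_def)
      \<comment> \<open>A hit in generation \<open>Suc N\<close> or later also counts for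
        \<open>{N..}\<close>, which brings the improved bound back to the tail started from.\<close>
      also have "\<dots> \<le> H {N..} x s" by (rule hit_prob_mono) auto
      finally show ?thesis .
    qed
    then have "J \<le> I" unfolding I_def by (intro cINF_greatest) auto
    with \<open>I < J\<close> show False by simp
  qed
  then have "H {N..} x s = 1" for N
    using I_le[of N s] hit_prob_le_1[of P \<mu> "{N..}" x s] by linarith
  then show ?thesis
    using LIMSEQ_unique[OF hit_prob_tendsto_inf[of P \<mu> x s]] by simp
qed

end

subsection \<open>Quasi-transitivity\<close>

lemma eq_map_pmf_of_bij:
  assumes "bij \<gamma>" "\<And>y. pmf q' (\<gamma> y) = pmf q y"
  shows "q' = map_pmf \<gamma> q"
proof (rule pmf_eqI)
  fix z
  obtain y where "z = \<gamma> y" using bij_is_surj[OF assms(1)] by blast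
  then show "pmf q' z = pmf (map_pmf \<gamma> q) z"
    using assms by (simp add: pmf_map_inj' bij_is_inj)
qed

context branching_chain
begin

lemma Aut_bmcD:
  assumes "\<gamma> \<in> Aut_bmc E P \<mu>"
  shows "bij \<gamma>" and "\<mu> (\<gamma> s) = \<mu> s" and "P (\<gamma> s) = map_pmf \<gamma> (P s)"
proof -
  have chain: "\<gamma> \<in> Aut_chain E P" and mu: "\<forall>k\<ge>1. \<forall>x. pmf (\<mu> x) k = pmf (\<mu> (\<gamma> x)) k"
    using assms unfolding Aut_bmc_def by blast+
  then show bij: "bij \<gamma>" by (simp add: Aut_chain_def Aut_def)
  show "P (\<gamma> s) = map_pmf \<gamma> (P s)"
    using chain by (intro eq_map_pmf_of_bij bij) (simp add: Aut_chain_def)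
  show "\<mu> (\<gamma> s) = \<mu> s"
  proof (rule pmf_eqI)
    fix k
    show "pmf (\<mu> (\<gamma> s)) k = pmf (\<mu> s) k"
    proof (cases "k = 0")
      \<comment> \<open>Invariance is required only for \<open>k \<ge> 1\<close>; at
        \<open>0\<close> both weights vanish since every particle has offspring.\<close>
      case True
      then show ?thesis using offspring_law.no_death[OF offspring] by simp
    next
      case False
      then show ?thesis by (intro mu[rule_format, symmetric]) simp
    qed
  qed
qed

text \<open>The recursion for finite horizons involves only \<open>P\<close>, \<open>\<mu>\<close>
  and the test \<open>s = x\<close>, all compatible with \<open>\<gamma>\<close>; the horizon is
  then sent to infinity.\<close>

lemma H_invariant:
  assumes "\<gamma> \<in> Aut_bmc E P \<mu>"
  shows "H UNIV (\<gamma> x) (\<gamma> s) = H UNIV x s"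
proof -
  have eq: "\<gamma> s = \<gamma> x \<longleftrightarrow> s = x" for s
    using bij_is_inj[OF Aut_bmcD(1)[OF assms]] by (simp add: inj_eq)
  have "H {..n} (\<gamma> x) (\<gamma> s) = H {..n} x s" for n
  proof (induction n arbitrary: s)
    case 0
    show ?case by (cases "s = x") (simp_all add: H_atMost_0 eq)
  next
    case (Suc n)
    show ?case
    proof (cases "s = x")
      case False
      then show ?thesis
        by (simp add: H_atMost_Suc eq branching_op_def Suc Aut_bmcD(2,3)[OF assms])
    qed simp
  qed
  then show ?thesis
    using LIMSEQ_unique[OF hit_prob_atMost_tendsto[of P \<mu> "\<gamma> x" "\<gamma> s"]] hit_prob_atMost_tendsto[of P \<mu> x s] by simp
qed

lemma quasi_transitive_orbits:
  assumes "quasi_transitive E P \<mu>"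
  obtains R where "finite R" "\<And>s. \<exists>r\<in>R. \<exists>\<gamma>\<in>Aut_bmc E P \<mu>. s = \<gamma> r"
proof -
  let ?orb = "\<lambda>x. {\<gamma> x |\<gamma>. \<gamma> \<in> Aut_bmc E P \<mu>}"
  have "finite (?orb ` UNIV)" using assms by (simp add: quasi_transitive_def)
  then obtain R where R: "finite R" "range ?orb = ?orb ` R"
    by (meson finite_subset_image subset_refl)
  have id: "id \<in> Aut_bmc E P \<mu>"
    by (simp add: Aut_bmc_def Aut_chain_def Aut_def)
  have "\<exists>r\<in>R. \<exists>\<gamma>\<in>Aut_bmc E P \<mu>. s = \<gamma> r" for s
  proof -
    have "?orb s \<in> ?orb ` R" using R(2) by blast
    then obtain r where r: "r \<in> R" "?orb s = ?orb r" by blast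
    have "s \<in> ?orb s" using id by (intro CollectI exI[of _ id]) simp
    then show ?thesis using r by blast
  qed
  with R(1) show ?thesis by (rule that)
qed

lemma finite_range_mu:
  assumes "quasi_transitive E P \<mu>"
  shows "finite (range \<mu>)"
proof -
  obtain R where R: "finite R" "\<And>s. \<exists>r\<in>R. \<exists>\<gamma>\<in>Aut_bmc E P \<mu>. s = \<gamma> r"
    using quasi_transitive_orbits[OF assms] by blast
  have "\<mu> s \<in> \<mu> ` R" for s
    using R(2)[of s] Aut_bmcD(2) by blast
  then have "range \<mu> \<subseteq> \<mu> ` R" by auto
  then show ?thesis using R(1) by (rule finite_surj[rotated])
qed

text \<open>An automorphism moves the starting point to one of finitely many representatives and
  carries the target to an arbitrary vertex. Hence the bound at each representative has to be
  uniform in the target beforehand.\<close>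

lemma H_uniformly_pos:
  assumes "quasi_transitive E P \<mu>" and ex: "\<And>z. \<exists>\<epsilon>>0. \<forall>x. \<epsilon> \<le> H UNIV x z"
  shows "\<exists>\<epsilon>>0. \<forall>x s. \<epsilon> \<le> H UNIV x s"
proof -
  obtain R where R: "finite R" "\<And>s. \<exists>r\<in>R. \<exists>\<gamma>\<in>Aut_bmc E P \<mu>. s = \<gamma> r"
    using quasi_transitive_orbits[OF assms(1)] by blast
  obtain d where d: "\<And>z. d z > 0" "\<And>z x. d z \<le> H UNIV x z"
    using ex by metis
  show ?thesis
  proof (intro exI[of _ "Min (d ` R)"] conjI allI)
    have "R \<noteq> {}" using R(2)[of undefined] by auto
    then show "0 < Min (d ` R)" using R(1) d(1) by simp
    fix x s
    obtain r \<gamma> where r: "r \<in> R" "\<gamma> \<in> Aut_bmc E P \<mu>" "s = \<gamma> r" using R(2) by blast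
    then have "surj \<gamma>" by (intro bij_is_surj Aut_bmcD)
    then obtain x' where x': "x = \<gamma> x'" by blast
    have "Min (d ` R) \<le> d r" using R(1) r by (intro Min_le) auto
    also have "\<dots> \<le> H UNIV x' r" by (rule d(2))
    also have "\<dots> = H UNIV x s" using H_invariant[OF r(2)] r x' by simp
    finally show "Min (d ` R) \<le> H UNIV x s" .
  qed
qed

text \<open>Pass to the limit in \<open>H {Suc N..} = \<Phi> (H {N..})\<close>: dominated
  convergence is applied first under \<open>P s\<close>, then under \<open>\<mu> s\<close>.\<close>

lemma inf_hit_prob_fixpoint: "\<Phi> (inf_hit_prob P \<mu> x) s = inf_hit_prob P \<mu> x s"
proof -
  define t where "t N = measure_pmf.expectation (P s) (H {N..} x)" for N
  have t01: "0 \<le> t N" "t N \<le> 1" for N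
    unfolding t_def by (auto intro!: expectation_unit_interval)
  have t: "t \<longlonglongrightarrow> measure_pmf.expectation (P s) (inf_hit_prob P \<mu> x)"
    unfolding t_def
    by (rule integral_dominated_convergence[where w = "\<lambda>_. 1"]) (auto intro: hit_prob_tendsto_inf)
  have "(\<lambda>N. measure_pmf.expectation (\<mu> s) (\<lambda>k. (1 - t N) ^ k)) \<longlonglongrightarrow>
      measure_pmf.expectation (\<mu> s) (\<lambda>k. (1 - measure_pmf.expectation (P s) (inf_hit_prob P \<mu> x)) ^ k)"
    by (rule integral_dominated_convergence[where w = "\<lambda>_. 1"])
      (use t01 in \<open>auto intro!: tendsto_intros t simp: power_le_one\<close>)
  then have "(\<lambda>N. \<Phi> (H {N..} x) s) \<longlonglongrightarrow> \<Phi> (inf_hit_prob P \<mu> x) s"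
    unfolding branching_op_def marked_prob_def t_def by (intro tendsto_intros)
  moreover have "(\<lambda>N. \<Phi> (H {N..} x) s) \<longlonglongrightarrow> inf_hit_prob P \<mu> x s"
    using LIMSEQ_Suc[OF hit_prob_tendsto_inf[of P \<mu> x s]] by (simp add: H_atLeast_Suc)
  ultimately show ?thesis by (rule LIMSEQ_unique)
qed

lemma inf_hit_prob_unit: "0 \<le> inf_hit_prob P \<mu> x s \<and> inf_hit_prob P \<mu> x s \<le> 1"
proof -
  interpret prob_space "bmc_space P \<mu>" by (rule prob_space_bmc_space)
  show ?thesis by (simp add: inf_hit_prob_def)
qed

lemma inf_hit_prob_le_H: "inf_hit_prob P \<mu> x s \<le> H UNIV x s"
  by (rule LIMSEQ_le_const2[OF hit_prob_tendsto_inf]) (auto intro: hit_prob_mono)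

end

subsection \<open>First passage and Green functions\<close>

text \<open>The generating function at \<open>c\<close> of the first passage time to
  \<open>x\<close>, truncated at time \<open>n\<close>. Values in \<open>ennreal\<close> allow its
  limit in \<open>n\<close> to be infinite.\<close>

primrec first_passage :: "('a \<Rightarrow> 'a pmf) \<Rightarrow> real \<Rightarrow> 'a \<Rightarrow> nat \<Rightarrow> 'a \<Rightarrow> ennreal" where
  "first_passage P c x 0 s = (if s = x then 1 else 0)"
| "first_passage P c x (Suc n) s =
    (if s = x then 1 else ennreal c * (\<integral>\<^sup>+y. first_passage P c x n y \<partial>measure_pmf (P s)))"

definition green :: "('a \<Rightarrow> 'a pmf) \<Rightarrow> real \<Rightarrow> 'a \<Rightarrow> 'a \<Rightarrow> ennreal" where
  "green P c x s = (\<Sum>k. ennreal (c ^ k * pmf (nstep P k s) x))"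

lemma first_passage_le_Suc: "first_passage P c x n s \<le> first_passage P c x (Suc n) s"
proof (induction n arbitrary: s)
  case (Suc n)
  then show ?case
    unfolding first_passage.simps(2)[of _ _ _ "Suc n"]
    by (auto intro!: mult_left_mono nn_integral_mono)
qed auto

lemma ennreal_rescale:
  assumes "0 < l"
  shows "ennreal c * ennreal (l ^ n) = ennreal (l ^ Suc n) * ennreal (c / l)"
proof -
  have "ennreal c * ennreal (l ^ n) = ennreal (l ^ Suc n * (c / l))"
    using assms by (simp add: ennreal_mult'' mult.commute)
  also have "\<dots> = ennreal (l ^ Suc n) * ennreal (c / l)"
    using assms by (intro ennreal_mult') simp
  finally show ?thesis .
qed

text \<open>A passage of length \<open>k \<le> n\<close> carries one factor \<open>c\<close> per
  step, and replacing \<open>c\<close> by \<open>c / l\<close> costs at most \<open>l ^ n\<close>.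
  This reduces statements at \<open>c\<close> to parameters below \<open>c\<close>.\<close>

lemma first_passage_scale:
  assumes "1 \<le> l"
  shows "first_passage P c x n s \<le> ennreal (l ^ n) * first_passage P (c / l) x n s"
proof (induction n arbitrary: s)
  case (Suc n)
  show ?case
  proof (cases "s = x")
    case False
    have "first_passage P c x (Suc n) s = ennreal c * (\<integral>\<^sup>+y. first_passage P c x n y \<partial>measure_pmf (P s))"
      using False by simp
    also have "\<dots> \<le> ennreal c * (\<integral>\<^sup>+y. ennreal (l ^ n) * first_passage P (c / l) x n y \<partial>measure_pmf (P s))"
      by (intro mult_left_mono nn_integral_mono Suc) auto
    also have "\<dots> = ennreal c * ennreal (l ^ n) * (\<integral>\<^sup>+y. first_passage P (c / l) x n y \<partial>measure_pmf (P s))"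
      by (simp add: nn_integral_cmult mult.assoc)
    also have "ennreal c * ennreal (l ^ n) = ennreal (l ^ Suc n) * ennreal (c / l)"
      using assms by (intro ennreal_rescale) simp
    finally show ?thesis using False by (simp add: mult.assoc)
  qed (use assms one_le_power[of l "Suc n"] in \<open>simp del: power_Suc\<close>)
qed auto

lemma green_rec:
  assumes "0 \<le> c"
  shows "green P c x s = (if s = x then 1 else 0) + ennreal c * (\<integral>\<^sup>+y. green P c x y \<partial>measure_pmf (P s))"
proof -
  have Suc: "ennreal (c ^ Suc k * pmf (nstep P (Suc k) s) x) =
      ennreal c * (\<integral>\<^sup>+y. ennreal (c ^ k * pmf (nstep P k y) x) \<partial>measure_pmf (P s))" for k
  proof -
    have "ennreal (c ^ Suc k * pmf (nstep P (Suc k) s) x) =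
        ennreal c * ennreal (c ^ k) * ennreal (measure_pmf.expectation (P s) (\<lambda>y. pmf (nstep P k y) x))"
      using assms by (simp add: pmf_nstep_Suc ennreal_mult' del: nstep.simps)
    also have "ennreal (measure_pmf.expectation (P s) (\<lambda>y. pmf (nstep P k y) x)) =
        (\<integral>\<^sup>+y. ennreal (pmf (nstep P k y) x) \<partial>measure_pmf (P s))"
      by (subst nn_integral_eq_integral) (auto simp: pmf_le_1)
    finally show ?thesis
      using assms by (simp add: nn_integral_cmult ennreal_mult' mult.assoc)
  qed
  have "green P c x s = ennreal (c ^ 0 * pmf (nstep P 0 s) x) +
      (\<Sum>k. ennreal (c ^ Suc k * pmf (nstep P (Suc k) s) x))"
    unfolding green_def by (subst suminf_offset[of _ 1]) (auto simp del: nstep.simps)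
  also have "(\<Sum>k. ennreal (c ^ Suc k * pmf (nstep P (Suc k) s) x)) =
      ennreal c * (\<integral>\<^sup>+y. green P c x y \<partial>measure_pmf (P s))"
    unfolding Suc green_def by (subst nn_integral_suminf) auto
  finally show ?thesis by (simp add: indicator_def)
qed

text \<open>Decomposing paths at their first visit to \<open>x\<close> factors the Green function;
  truncating the passage time leaves one inequality.\<close>

lemma green_ge_first_passage:
  assumes "0 \<le> c"
  shows "green P c x x * first_passage P c x n s \<le> green P c x s"
proof (induction n arbitrary: s)
  case (Suc n)
  show ?case
  proof (cases "s = x")
    case False
    have "green P c x x * first_passage P c x (Suc n) s =
        ennreal c * (\<integral>\<^sup>+y. green P c x x * first_passage P c x n y \<partial>measure_pmf (P s))"
      using False by (simp add: nn_integral_cmult mult_ac)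
    also have "\<dots> \<le> ennreal c * (\<integral>\<^sup>+y. green P c x y \<partial>measure_pmf (P s))"
      by (intro mult_left_mono nn_integral_mono Suc) auto
    also have "\<dots> = green P c x s" using False assms by (subst (2) green_rec) auto
    finally show ?thesis .
  qed simp
qed auto

text \<open>The renewal equation at \<open>x\<close> gives \<open>G \<ge> 1 + G * U\<close>, where
  \<open>G\<close> is the Green function and \<open>U\<close> the truncated first return sum. For
  finite \<open>G\<close> this excludes \<open>U \<ge> 1\<close>.\<close>

lemma first_return_less_1:
  assumes "0 \<le> c" "green P c x x < \<infinity>"
  shows "ennreal c * (\<integral>\<^sup>+y. first_passage P c x n y \<partial>measure_pmf (P x)) < 1"
proof (rule ccontr)
  assume "\<not> ?thesis"
  then have 1: "1 \<le> ennreal c * (\<integral>\<^sup>+y. first_passage P c x n y \<partial>measure_pmf (P x))" by simp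
  have "1 + green P c x x * 1 \<le>
      1 + green P c x x * (ennreal c * (\<integral>\<^sup>+y. first_passage P c x n y \<partial>measure_pmf (P x)))"
    by (intro add_left_mono mult_left_mono 1) auto
  also have "\<dots> = 1 + ennreal c * (\<integral>\<^sup>+y. green P c x x * first_passage P c x n y \<partial>measure_pmf (P x))"
    by (simp add: nn_integral_cmult mult_ac)
  also have "\<dots> \<le> 1 + ennreal c * (\<integral>\<^sup>+y. green P c x y \<partial>measure_pmf (P x))"
    by (intro add_left_mono mult_left_mono nn_integral_mono green_ge_first_passage assms) auto
  also have "\<dots> = green P c x x" using assms by (subst (2) green_rec) auto
  finally have "1 + green P c x x \<le> green P c x x" by simp
  moreover obtain r where "green P c x x = ennreal r" "0 \<le> r"
    using assms(2) by (cases "green P c x x") auto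
  ultimately show False
    by (simp flip: ennreal_1 ennreal_plus)
qed

text \<open>At \<open>c\<close> itself the Green function may diverge, as can happen at the critical
  mean. The strict bound is therefore used at \<open>c / l\<close> with \<open>l > 1\<close>; as
  \<open>n\<close> is fixed, the cost \<open>l ^ Suc n\<close> tends to \<open>1\<close> when
  \<open>l\<close> decreases to \<open>1\<close>.\<close>

lemma first_return_le_1:
  assumes "0 < c" "\<And>c'. 0 < c' \<Longrightarrow> c' < c \<Longrightarrow> green P c' x x < \<infinity>"
  shows "ennreal c * (\<integral>\<^sup>+y. first_passage P c x n y \<partial>measure_pmf (P x)) \<le> 1"
proof (rule tendsto_lowerbound)
  show "((\<lambda>l. ennreal (l ^ Suc n)) \<longlongrightarrow> 1) (at_right 1)"
    by (auto intro!: tendsto_eq_intros simp del: power_Suc)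
  show "\<forall>\<^sub>F l in at_right 1. ennreal c * (\<integral>\<^sup>+y. first_passage P c x n y \<partial>measure_pmf (P x)) \<le> ennreal (l ^ Suc n)"
    using eventually_at_right_less
  proof eventually_elim
    case (elim l)
    have "ennreal c * (\<integral>\<^sup>+y. first_passage P c x n y \<partial>measure_pmf (P x)) \<le>
        ennreal c * (\<integral>\<^sup>+y. ennreal (l ^ n) * first_passage P (c / l) x n y \<partial>measure_pmf (P x))"
      using elim by (intro mult_left_mono nn_integral_mono first_passage_scale) auto
    also have "\<dots> = ennreal c * ennreal (l ^ n) * (\<integral>\<^sup>+y. first_passage P (c / l) x n y \<partial>measure_pmf (P x))"
      by (simp add: nn_integral_cmult mult.assoc)
    also have "ennreal c * ennreal (l ^ n) = ennreal (l ^ Suc n) * ennreal (c / l)"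
      using elim by (intro ennreal_rescale) simp
    also have "\<dots> * (\<integral>\<^sup>+y. first_passage P (c / l) x n y \<partial>measure_pmf (P x)) \<le> ennreal (l ^ Suc n) * 1"
      unfolding mult.assoc using elim assms(1)
      by (intro mult_left_mono less_imp_le first_return_less_1 assms(2)) (auto simp: field_simps)
    finally show ?case by simp
  qed
qed auto

subsection \<open>Transience\<close>

context branching_chain
begin

lemma branching_op_le_nn_integral:
  assumes "\<And>s. 0 \<le> f s \<and> f s \<le> 1"
  shows "ennreal (\<Phi> f s) \<le> ennreal m * (\<integral>\<^sup>+y. ennreal (f y) \<partial>measure_pmf (P s))"
proof -
  have m: "0 \<le> m" using offspring_law.mean_gt_1[OF offspring] by simp
  have "\<Phi> f s \<le> m * measure_pmf.expectation (P s) f"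
    unfolding branching_op_def using assms
    by (intro offspring_law.marked_prob_le_mean[OF offspring] expectation_unit_interval) auto
  then have "ennreal (\<Phi> f s) \<le> ennreal m * ennreal (measure_pmf.expectation (P s) f)"
    using m by (simp add: ennreal_leI flip: ennreal_mult')
  then show ?thesis using assms by (subst nn_integral_eq_integral) auto
qed

text \<open>A first-moment bound: \<open>marked_prob\<close> is at most \<open>m * t\<close>, which
  turns the branching recursion into the linear first passage recursion at \<open>m\<close>.\<close>

lemma H_atMost_le_first_passage: "ennreal (H {..n} x s) \<le> first_passage P m x n s"
proof (induction n arbitrary: s)
  case 0
  show ?case by (cases "s = x") (simp_all add: H_atMost_0)
next
  case (Suc n)
  show ?case
  proof (cases "s = x")
    case False
    then have "ennreal (H {..Suc n} x s) \<le> ennreal m * (\<integral>\<^sup>+y. ennreal (H {..n} x y) \<partial>measure_pmf (P s))"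
      by (simp add: H_atMost_Suc branching_op_le_nn_integral)
    also have "\<dots> \<le> ennreal m * (\<integral>\<^sup>+y. first_passage P m x n y \<partial>measure_pmf (P s))"
      by (intro mult_left_mono nn_integral_mono Suc) auto
    finally show ?thesis using False by simp
  qed simp
qed

lemma inf_hit_prob_eq_0:
  assumes return: "\<And>n. ennreal m * (\<integral>\<^sup>+y. first_passage P m x n y \<partial>measure_pmf (P x)) \<le> 1"
  shows "inf_hit_prob P \<mu> x x = 0"
proof (rule ccontr)
  define F where "F = inf_hit_prob P \<mu> x"
  assume "inf_hit_prob P \<mu> x x \<noteq> 0"
  then have Fx: "0 < F x" using inf_hit_prob_unit[of x x] by (simp add: F_def)
  have F: "0 \<le> F s \<and> F s \<le> 1" for s by (simp add: F_def inf_hit_prob_unit)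
  define f where "f = first_passage P m x"
  define g where "g s = (SUP n. f n s)" for s
  have f_le_g: "f n s \<le> g s" for n s unfolding g_def by (rule SUP_upper) simp
  have inc: "incseq f"
    by (auto simp: incseq_Suc_iff le_fun_def f_def simp del: first_passage.simps intro: first_passage_le_Suc)
  have int_g: "ennreal m * (\<integral>\<^sup>+y. g y \<partial>measure_pmf (P s)) =
      (SUP n. ennreal m * (\<integral>\<^sup>+y. f n y \<partial>measure_pmf (P s)))" for s
    unfolding g_def by (subst nn_integral_monotone_convergence_SUP[OF inc]) (auto simp: SUP_mult_left_ennreal)
  have F_le_g: "ennreal (F s) \<le> g s" for s
  proof -
    have "(\<lambda>n. ennreal (H {..n} x s)) \<longlonglongrightarrow> ennreal (H UNIV x s)"
      by (intro tendsto_ennrealI hit_prob_atMost_tendsto)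
    moreover have "ennreal (H {..n} x s) \<le> g s" for n
      using H_atMost_le_first_passage[of n x s] f_le_g[of n s] by (simp add: f_def)
    ultimately have "ennreal (H UNIV x s) \<le> g s"
      by (blast intro: LIMSEQ_le_const2)
    then show ?thesis
      using inf_hit_prob_le_H[of x s] by (auto simp: F_def intro: order_trans ennreal_leI)
  qed
  have F_fix: "\<Phi> F s = F s" for s by (simp add: F_def inf_hit_prob_fixpoint)
  have F_int: "ennreal (F s) \<le> ennreal m * (\<integral>\<^sup>+y. ennreal (F y) \<partial>measure_pmf (P s))" for s
    using branching_op_le_nn_integral[of F s, OF F] unfolding F_fix .
  \<comment> \<open>This is \<open>F - F x * f n \<le> g - f n\<close> written without subtraction.
    Iterating \<open>F \<le> m P F\<close> and stopping at \<open>x\<close>, the passages completed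
    by time \<open>n\<close> contribute \<open>F x * f n\<close>, and the remainder of
    \<open>g\<close> bounds what is left.\<close>
  have bound: "ennreal (F s) + f n s \<le> ennreal (F x) * f n s + g s" for n s
  proof (induction n arbitrary: s)
    case 0
    show ?case using F_le_g[of s] f_le_g[of 0 s] by (cases "s = x") (auto simp: f_def)
  next
    case (Suc n)
    show ?case
    proof (cases "s = x")
      case True
      then show ?thesis using f_le_g[of "Suc n" s] by (simp add: f_def)
    next
      case False
      have "ennreal (F s) + f (Suc n) s \<le>
          ennreal m * (\<integral>\<^sup>+y. ennreal (F y) \<partial>measure_pmf (P s)) + ennreal m * (\<integral>\<^sup>+y. f n y \<partial>measure_pmf (P s))"
        using False F_int[of s] by (intro add_mono) (simp_all add: f_def)
      also have "\<dots> = ennreal m * (\<integral>\<^sup>+y. ennreal (F y) + f n y \<partial>measure_pmf (P s))"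
        by (simp add: nn_integral_add distrib_left)
      also have "\<dots> \<le> ennreal m * (\<integral>\<^sup>+y. ennreal (F x) * f n y + g y \<partial>measure_pmf (P s))"
        by (intro mult_left_mono nn_integral_mono Suc) auto
      also have "\<dots> = ennreal (F x) * (ennreal m * (\<integral>\<^sup>+y. f n y \<partial>measure_pmf (P s)))
          + ennreal m * (\<integral>\<^sup>+y. g y \<partial>measure_pmf (P s))"
        by (simp add: nn_integral_add nn_integral_cmult distrib_left mult_ac)
      also have "\<dots> \<le> ennreal (F x) * f (Suc n) s + g s"
        unfolding int_g using False f_le_g[of "Suc _" s]
        by (intro add_mono SUP_least) (simp_all add: f_def)
      finally show ?thesis .
    qed
  qed
  have F_le: "ennreal (F s) \<le> ennreal (F x) * g s" for s
  \<comment> \<open>For infinite \<open>g s\<close> the right side is infinite because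
    \<open>F x > 0\<close>; otherwise \<open>g s\<close> can be cancelled after letting
    \<open>n\<close> grow.\<close>
  proof (cases "g s = \<infinity>")
    case True
    then show ?thesis using Fx by (simp add: ennreal_mult_top)
  next
    case False
    have "(\<lambda>n. f n s) \<longlonglongrightarrow> g s"
      unfolding g_def using inc by (intro LIMSEQ_SUP) (auto simp: mono_def le_fun_def)
    then have "(\<lambda>n. ennreal (F s) + f n s) \<longlonglongrightarrow> ennreal (F s) + g s"
      by (intro tendsto_intros)
    then have "ennreal (F s) + g s \<le> ennreal (F x) * g s + g s"
    proof (rule LIMSEQ_le_const2, intro exI allI impI)
      fix n
      show "ennreal (F s) + f n s \<le> ennreal (F x) * g s + g s"
        using bound[of s n] f_le_g[of n s] by (meson add_right_mono mult_left_mono order_trans zero_le)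
    qed
    then show ?thesis using False by (simp add: add.commute[of _ "g s"] ennreal_add_left_cancel_le)
  qed
  define t where "t = measure_pmf.expectation (P x) F"
  have t01: "0 \<le> t" "t \<le> 1" unfolding t_def using F by (auto intro!: expectation_unit_interval)
  have "ennreal (m * t) = ennreal m * (\<integral>\<^sup>+y. ennreal (F y) \<partial>measure_pmf (P x))"
    using F offspring_law.mean_gt_1[OF offspring] by (subst nn_integral_eq_integral) (auto simp: t_def ennreal_mult')
  also have "\<dots> \<le> ennreal m * (\<integral>\<^sup>+y. ennreal (F x) * g y \<partial>measure_pmf (P x))"
    by (intro mult_left_mono nn_integral_mono F_le) auto
  also have "\<dots> = ennreal (F x) * (ennreal m * (\<integral>\<^sup>+y. g y \<partial>measure_pmf (P x)))"
    by (subst nn_integral_cmult, simp) (rule mult.left_commute)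
  also have "\<dots> \<le> ennreal (F x) * 1"
    unfolding int_g using return by (intro mult_left_mono SUP_least) (auto simp: f_def)
  finally have "m * t \<le> F x" using Fx by simp
  have "F x = marked_prob (\<mu> x) t"
    unfolding t_def using F_fix[of x] by (simp add: branching_op_def)
  moreover have "t \<noteq> 0"
    using Fx calculation offspring_law.marked_prob_0[OF offspring] by auto
  moreover have "marked_prob (\<mu> x) t < m * t" if "0 < t"
    using that t01 by (intro offspring_law.marked_prob_less_mean[OF offspring])
  ultimately show False using \<open>m * t \<le> F x\<close> t01 by simp
qed

end

subsection \<open>The spectral radius\<close>

lemma pmf_nstep_add3_ge:
  "pmf (nstep P a x) y * (pmf (nstep P n y) z * pmf (nstep P b z) w) \<le> pmf (nstep P (a + (n + b)) x) w"
proof -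
  have "pmf (nstep P a x) y * (pmf (nstep P n y) z * pmf (nstep P b z) w)
      \<le> pmf (nstep P a x) y * pmf (nstep P (n + b) y) w"
    by (rule mult_left_mono[OF pmf_nstep_add_ge pmf_nonneg])
  also have "\<dots> \<le> pmf (nstep P (a + (n + b)) x) w"
    by (rule pmf_nstep_add_ge)
  finally show ?thesis .
qed

lemma spectral_radius_nonneg: "0 \<le> spectral_radius P u v"
  unfolding spectral_radius_def
  by (rule le_Limsup) (auto intro!: always_eventually real_root_pos_pos_le)

text \<open>The root test gives convergence for the pair \<open>u\<close>, \<open>v\<close>, at
  which the spectral radius is taken. Irreducibility transfers it to \<open>x\<close>: joining
  \<open>u\<close> to \<open>x\<close> and \<open>x\<close> to \<open>v\<close> by fixed paths costs
  only the constant factor \<open>A\<close>.\<close>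

lemma green_finite_of_spectral_radius:
  assumes "irreducible_chain P" and c: "0 < c" "c < m" and "ereal m \<le> 1 / spectral_radius P u v"
  shows "green P c x x < \<infinity>"
proof -
  define p where "p n = pmf (nstep P n u) v" for n
  define L where "L = limsup (\<lambda>n. ereal (root n (p n)))"
  have L: "spectral_radius P u v = L" by (simp add: spectral_radius_def L_def p_def)
  have "L < ereal (1 / c)"
  proof (rule ccontr)
    assume "\<not> ?thesis"
    then have "ereal (1 / c) \<le> L" by simp
    moreover have "ereal m \<le> 1 / L"
      using assms(4) by (simp add: L)
    ultimately show False
    proof (cases L)
      case (real l)
      then have "1 / c \<le> l" using \<open>ereal (1 / c) \<le> L\<close> by simp
      then have "1 \<le> c * l" using c by (simp add: field_simps)
      moreover have "0 < 1 / c" using c by simp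
      then have "0 < l" using \<open>1 / c \<le> l\<close> by linarith
      moreover have "m \<le> 1 / l"
        using \<open>ereal m \<le> 1 / L\<close> real \<open>0 < l\<close> by (simp add: one_ereal_def)
      then have "m * l \<le> 1" using \<open>0 < l\<close> by (simp add: field_simps)
      moreover have "c * l < m * l" using c \<open>0 < l\<close> by simp
      ultimately show False by linarith
    qed (use c in auto)
  qed
  then obtain r where r: "L < ereal r" "r < 1 / c"
    using ereal_dense2[of L "ereal (1 / c)"] by auto
  have "eventually (\<lambda>n. ereal (root n (p n)) < ereal r) sequentially"
    using r(1) unfolding L_def by (rule Limsup_lessD)
  then have "eventually (\<lambda>n. norm (c ^ n * p n) \<le> (c * \<bar>r\<bar>) ^ n) sequentially"
    \<comment> \<open>Index \<open>0\<close> is discarded, since \<open>root 0\<close> is constantly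
      \<open>0\<close> and says nothing about \<open>p 0\<close>.\<close>
    using eventually_gt_at_top[of 0]
  proof eventually_elim
    case (elim n)
    then have "0 \<le> root n (p n)" "root n (p n) < r"
      by (auto simp: p_def)
    then have "root n (p n) ^ n \<le> \<bar>r\<bar> ^ n" by (intro power_mono) auto
    then have "p n \<le> \<bar>r\<bar> ^ n" using elim by (simp add: p_def)
    then show ?case using c by (simp add: p_def power_mult_distrib abs_mult)
  qed
  moreover have "0 < r"
  proof -
    have "0 \<le> L" using spectral_radius_nonneg[of P u v] by (simp add: L)
    then have "0 < ereal r" using r(1) by (rule order.strict_trans1)
    then show ?thesis by simp
  qed
  then have "norm (c * \<bar>r\<bar>) < 1" using r(2) c by (simp add: field_simps)
  then have "summable (\<lambda>n. (c * \<bar>r\<bar>) ^ n)" by (rule summable_geometric)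
  ultimately have summable: "summable (\<lambda>n. c ^ n * p n)" by (rule summable_comparison_test_ev)
  obtain a where a: "0 < pmf (nstep P a u) x"
    using assms(1) by (auto simp: irreducible_chain_def)
  obtain b where b: "0 < pmf (nstep P b x) v"
    using assms(1) by (auto simp: irreducible_chain_def)
  note ab = a b
  define A where "A = c ^ (a + b) * (pmf (nstep P a u) x * pmf (nstep P b x) v)"
  have A: "0 < A" using ab c by (simp add: A_def)
  have "summable (\<lambda>n. c ^ (n + (a + b)) * p (n + (a + b)))"
    using summable by (rule summable_ignore_initial_segment)
  then have "summable (\<lambda>n. c ^ (n + (a + b)) * p (n + (a + b)) / A)"
    by (rule summable_divide)
  then have "summable (\<lambda>n. c ^ n * pmf (nstep P n x) x)"
  proof (rule summable_comparison_test')
    fix n :: nat assume "0 \<le> n"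
    have "a + (n + b) = n + (a + b)" by simp
    then have "pmf (nstep P a u) x * (pmf (nstep P n x) x * pmf (nstep P b x) v) \<le> p (n + (a + b))"
      unfolding p_def by (metis pmf_nstep_add3_ge)
    then have "c ^ (n + (a + b)) * (pmf (nstep P a u) x * (pmf (nstep P n x) x * pmf (nstep P b x) v))
        \<le> c ^ (n + (a + b)) * p (n + (a + b))"
      by (rule mult_left_mono) (use c in simp)
    also have "c ^ (n + (a + b)) * (pmf (nstep P a u) x * (pmf (nstep P n x) x * pmf (nstep P b x) v))
        = (c ^ n * pmf (nstep P n x) x) * A"
      by (simp only: A_def power_add ac_simps)
    finally show "norm (c ^ n * pmf (nstep P n x) x) \<le> c ^ (n + (a + b)) * p (n + (a + b)) / A"
      using A c by (simp add: pos_le_divide_eq)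
  qed
  then have "(\<Sum>k. ennreal (c ^ k * pmf (nstep P k x) x)) \<noteq> top"
    by (rule ennreal_suminf_neq_top) (use c in simp)
  then show ?thesis
    unfolding green_def infinity_ennreal_def by (rule less_top[THEN iffD1])
qed

text \<open>For \<open>q\<close> strictly between \<open>1 / m\<close> and the spectral radius,
  \<open>p n \<ge> q ^ n\<close> holds for arbitrarily large \<open>n\<close>. With
  \<open>1 / q < r < m\<close> the factor \<open>(r * q) ^ n\<close> grows without bound, so it
  outweighs the fixed cost of joining \<open>z\<close> to \<open>u\<close> and \<open>v\<close> to
  \<open>z\<close>.\<close>

lemma supercritical_of_spectral_radius:
  assumes "irreducible_chain P" and m: "0 < m" and "ereal m > 1 / spectral_radius P u v"
  shows "\<exists>r k. 0 < r \<and> r < m \<and> 1 \<le> k \<and> 1 \<le> r ^ k * pmf (nstep P k z) z"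
proof -
  define p where "p n = pmf (nstep P n u) v" for n
  define L where "L = limsup (\<lambda>n. ereal (root n (p n)))"
  have L: "spectral_radius P u v = L" by (simp add: spectral_radius_def L_def p_def)
  have "0 \<le> L" using spectral_radius_nonneg[of P u v] by (simp add: L)
  have "ereal (1 / m) < L"
  proof (rule ccontr)
    assume "\<not> ?thesis"
    then have "L \<le> ereal (1 / m)" by simp
    moreover have "1 / L < ereal m"
      using assms(3) by (simp add: L)
    ultimately show False
      using m \<open>0 \<le> L\<close> by (cases L) (auto simp: field_simps one_ereal_def split: if_splits)
  qed
  then obtain q where q: "1 / m < q" "ereal q < L"
    using ereal_dense2[of "ereal (1 / m)" L] by auto
  have q_pos: "0 < q" using q(1) m by (meson less_trans zero_less_divide_1_iff)
  have large: "\<exists>n\<ge>N. 1 \<le> n \<and> q ^ n \<le> p n" for N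
  proof (rule ccontr)
    assume no: "\<not> ?thesis"
    have "ereal (root n (p n)) \<le> ereal q" if "n \<ge> max 1 N" for n
    proof -
      have "p n < q ^ n" using no that by force
      then have "root n (p n) < root n (q ^ n)" using that by (intro real_root_less_mono) auto
      then show ?thesis using that q_pos by (simp add: real_root_power_cancel)
    qed
    then have "eventually (\<lambda>n. ereal (root n (p n)) \<le> ereal q) sequentially"
      unfolding eventually_sequentially by blast
    then have "L \<le> ereal q" unfolding L_def by (rule Limsup_bounded)
    with q show False by simp
  qed
  define r where "r = (1 / q + m) / 2"
  have "1 / q < m" using q(1) q_pos m by (simp add: field_simps)
  then have r: "1 / q < r" "r < m" by (auto simp: r_def)
  have r_pos: "0 < r" using r(1) q_pos by (meson less_trans zero_less_divide_1_iff)
  obtain a where a: "0 < pmf (nstep P a z) u"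
    using assms(1) by (auto simp: irreducible_chain_def)
  obtain b where b: "0 < pmf (nstep P b v) z"
    using assms(1) by (auto simp: irreducible_chain_def)
  note ab = a b
  define A where "A = r ^ (a + b) * (pmf (nstep P a z) u * pmf (nstep P b v) z)"
  have A: "0 < A" using ab r_pos by (simp add: A_def)
  have rq: "1 < r * q" using r(1) q_pos by (simp add: field_simps)
  \<comment> \<open>\<open>A\<close> is the weight of the two connecting paths, and beyond
    \<open>N\<close> the geometric growth exceeds \<open>1 / A\<close>. The resulting return time is
    \<open>k = a + (n + b)\<close>.\<close>
  obtain N where N: "1 / A < (r * q) ^ N" using real_arch_pow[OF rq] by blast
  obtain n where n: "N \<le> n" "1 \<le> n" "q ^ n \<le> p n" using large by blast
  have "1 / A \<le> (r * q) ^ n"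
    using N power_increasing[OF n(1), of "r * q"] rq by linarith
  also have "\<dots> \<le> r ^ n * p n"
    using n(3) r_pos by (simp add: power_mult_distrib)
  finally have "1 \<le> A * (r ^ n * p n)" using A by (simp add: field_simps)
  also have "\<dots> = r ^ (a + (n + b)) * (pmf (nstep P a z) u * (p n * pmf (nstep P b v) z))"
    by (simp only: A_def power_add ac_simps)
  also have "\<dots> \<le> r ^ (a + (n + b)) * pmf (nstep P (a + (n + b)) z) z"
    unfolding p_def using r_pos
    by (intro mult_left_mono pmf_nstep_add3_ge) simp
  finally show ?thesis
    using r r_pos n(2) by (intro exI[of _ r] exI[of _ "a + (n + b)"]) simp
qed

section \<open>Transience and strong recurrence in the two regimes of \<open>m\<close>\<close>

theorem theorem3p4:
  fixes E :: "'a::countable \<Rightarrow> 'a \<Rightarrow> bool"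
    and P :: "'a \<Rightarrow> 'a pmf"
    and \<mu> :: "'a \<Rightarrow> nat pmf"
    and m :: real
    and u v :: 'a
  assumes "symp E" and "locally_finite_graph E" and "connected_graph E"
    and "irreducible_chain P"
    and "\<And>x. pmf (\<mu> x) 0 = 0"
    and "\<And>x. (\<lambda>k. real k * pmf (\<mu> x) k) sums m"
    and "1 < m"
    and "quasi_transitive E P \<mu>"
  shows "(ereal m \<le> 1 / spectral_radius P u v \<longrightarrow> transient_bmc P \<mu>) \<and>
         (ereal m > 1 / spectral_radius P u v \<longrightarrow> strongly_recurrent_bmc P \<mu>)"
proof (intro conjI impI)
  interpret branching_chain P \<mu> m
    using assms(4-7) by unfold_locales (auto intro!: offspring_law.intro)
  {
    assume "ereal m \<le> 1 / spectral_radius P u v"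
    then have "green P c x x < \<infinity>" if "0 < c" "c < m" for c x
      using green_finite_of_spectral_radius[OF assms(4)] that by blast
    then have "inf_hit_prob P \<mu> x x = 0" for x
      using assms(7) by (intro inf_hit_prob_eq_0 first_return_le_1) auto
    then show "transient_bmc P \<mu>"
      by (simp add: transient_bmc_def return_prob_eq)
  }
  {
    assume m: "ereal m > 1 / spectral_radius P u v"
    have "\<exists>\<epsilon>>0. \<forall>x. \<epsilon> \<le> H UNIV x z" for z
    proof -
      obtain r k where "0 < r" "r < m" "1 \<le> k" "1 \<le> r ^ k * pmf (nstep P k z) z"
        using supercritical_of_spectral_radius[OF assms(4) _ m, of z] assms(7) by auto
      then show ?thesis by (rule H_ge_from_supercritical[OF finite_range_mu[OF assms(8)]])
    qed
    then obtain \<epsilon> where "0 < \<epsilon>" "\<And>x s. \<epsilon> \<le> H UNIV x s"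
      using H_uniformly_pos[OF assms(8)] by blast
    then have "inf_hit_prob P \<mu> x x = 1" for x
      by (intro inf_hit_prob_eq_1[OF finite_range_mu[OF assms(8)]])
    then show "strongly_recurrent_bmc P \<mu>"
      by (simp add: strongly_recurrent_bmc_def return_prob_eq)
  }
qed

end
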